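(* There is an absolute constant $C$ such that the following holds. For every $n\ge 1$ and every edge-colouring $\chi$ (with an arbitrary number of colours) of the complete graph $K_n$ that is $3$-mean, i.e. satisfies \[ \frac{1}{n}\sum_{v\in V(K_n)} d_\chi(v)\le 3, \] the vertex set $V(K_n)$ can be partitioned into the vertex sets of at most $C$ pairwise vertex-disjoint monochromatic cycles.
   Context: All graphs are finite. An edge-colouring is an arbitrary assignment of colours to edges (not necessarily proper), with no bound on the total number of colours. For an edge-colouring $\chi$ of a graph $G$, the palette of a vertex $v$ is $\mathcal P(v):=\{\chi(vu): vu\in E(G)\}$, and the colour-degree of $v$ is $d_\chi(v):=|\mathcal P(v)|$. Convention: single edges, single vertices and the empty set are regarded as cycles. A cycle in an edge-coloured graph is monochromatic if all of its edges have the same colour (so a single vertex, a single edge and the empty set are monochromatic cycles). *)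

theory Defs
  imports Complex_Main "HOL-Library.Disjoint_Sets"
begin

text \<open>A finite simple graph is given by a vertex set \<open>V\<close> and a set \<open>E\<close> of edges, each
  edge being a two-element subset of \<open>V\<close>. An edge-colouring is a function on sets of vertices;
  only its values on edges matter.\<close>

definition complete_edges :: "'a set \<Rightarrow> 'a set set" where
  "complete_edges V = {{u, v} | u v. u \<in> V \<and> v \<in> V \<and> u \<noteq> v}"

definition palette :: "'a set set \<Rightarrow> ('a set \<Rightarrow> 'c) \<Rightarrow> 'a \<Rightarrow> 'c set" where
  "palette E \<chi> v = {\<chi> {v, u} | u. {v, u} \<in> E}"

definition colour_degree :: "'a set set \<Rightarrow> ('a set \<Rightarrow> 'c) \<Rightarrow> 'a \<Rightarrow> nat" where
  "colour_degree E \<chi> v = card (palette E \<chi> v)"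

definition mean_colouring :: "real \<Rightarrow> 'a set \<Rightarrow> 'a set set \<Rightarrow> ('a set \<Rightarrow> 'c) \<Rightarrow> bool" where
  "mean_colouring r V E \<chi> \<longleftrightarrow>
     1 / real (card V) * (\<Sum>v\<in>V. real (colour_degree E \<chi> v)) \<le> r"

text \<open>A cycle is represented by the list of its vertices in cyclic order. The lists of
  length 0, 1 and 2 represent the degenerate cycles: the empty set, a single vertex (without
  edges) and a single edge. For length 2 the formula below yields that one edge, and for length 1
  it would yield a loop, which is why that length is excluded.\<close>

definition cycle_edges :: "'a list \<Rightarrow> 'a set set" where
  "cycle_edges vs =
     (if length vs \<le> 1 then {}
      else {{vs ! i, vs ! (Suc i mod length vs)} | i. i < length vs})"

definition is_cycle :: "'a set \<Rightarrow> 'a set set \<Rightarrow> 'a list \<Rightarrow> bool" where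
  "is_cycle V E vs \<longleftrightarrow> distinct vs \<and> set vs \<subseteq> V \<and> cycle_edges vs \<subseteq> E"

definition monochromatic :: "('a set \<Rightarrow> 'c) \<Rightarrow> 'a list \<Rightarrow> bool" where
  "monochromatic \<chi> vs \<longleftrightarrow> (\<forall>e\<in>cycle_edges vs. \<forall>f\<in>cycle_edges vs. \<chi> e = \<chi> f)"

definition partitioned_by_mono_cycles ::
    "'a set \<Rightarrow> 'a set set \<Rightarrow> ('a set \<Rightarrow> 'c) \<Rightarrow> nat \<Rightarrow> bool" where
  "partitioned_by_mono_cycles V E \<chi> k \<longleftrightarrow>
     (\<exists>\<C>. finite \<C> \<and> card \<C> \<le> k
        \<and> (\<forall>vs\<in>\<C>. is_cycle V E vs \<and> monochromatic \<chi> vs)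
        \<and> disjoint_family_on set \<C>
        \<and> (\<Union>vs\<in>\<C>. set vs) = V)"

end

theory Submission
  imports Defs
begin

text \<open>
  A vertex of huge colour-degree must be compensated by vertices of colour-degree at most \<open>2\<close>, so
  the set \<open>H\<close> of vertices whose colour-degree exceeds a large constant is much smaller than the set
  \<open>M\<close> of those of colour-degree at most \<open>2\<close>. The proof covers \<open>H\<close> by boundedly many monochromatic
  cycles inside \<open>H \<union> M\<close> (lemma \<open>cover_high_degrees\<close>). The vertices left over carry a local colouring,
  in which every vertex sees boundedly many colours, and such colourings are known to admit a
  partition into boundedly many monochromatic cycles (a theorem of Conlon and Stein, here
  \<open>local_cycle_partition\<close>).

  Both parts rest on one device. If every vertex of a small set \<open>Y\<close> sends a positive proportion
  of its edges to a large set \<open>X\<close> in one colour, and every vertex of \<open>X\<close> sees boundedly many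
  colours, then among any sufficiently large bounded number of vertices of \<open>Y\<close> two have many common
  neighbours in the same colour. The graph of these pairs has bounded independence number, and
  Posa's theorem (\<open>cyclic_partition\<close>) covers it by boundedly many cycles. Since \<open>Y\<close> is
  small, the edges of these cycles can be replaced by paths of length two through distinct
  vertices of \<open>X\<close> (\<open>linking\<close>, \<open>cover_small_set\<close>).

  For local colourings this is combined with the absorption method of Erdos, Gyarfas and Pyber. The
  absorber is a family of monochromatic cycles in which linearly many vertices are optional; it is
  obtained by linking edges that have linearly many common neighbours in their own colour.

  To cover \<open>H\<close>, note that the palettes of the vertices of \<open>M\<close> are sets of at most two
  colours any two of which intersect. If they contain at most three colours in total, \<open>cover_small_set\<close>
  applies directly. Otherwise they have a colour \<open>c\<^sub>0\<close> in common. Vertices of \<open>H\<close> joined to half of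
  \<open>M\<close> in colour \<open>c\<^sub>0\<close> are again linked directly. A vertex of colour-degree \<open>k\<close> that is joined to half
  of \<open>M\<close> in other colours splits this half into at most \<open>k\<close> classes, on each of which every edge to \<open>H\<close> has
  one of two colours. If \<open>k\<close> is the least colour-degree of such vertices, there are only \<open>O(card M / k)\<close>
  of them, so that typical classes are large enough to share the work (\<open>cover_star_heavy\<close>).\<close>

section \<open>Cyclic lists\<close>

definition cyclic :: "('a \<Rightarrow> 'a \<Rightarrow> bool) \<Rightarrow> 'a list \<Rightarrow> bool" where
  "cyclic R p \<longleftrightarrow> p \<noteq> [] \<and> successively R (p @ [hd p])"

lemma cyclic_conv_nth:
  "cyclic R p \<longleftrightarrow> p \<noteq> [] \<and> (\<forall>i<length p. R (p ! i) (p ! (Suc i mod length p)))"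
proof (cases "p = []")
  case False
  have "R ((p @ [hd p]) ! i) ((p @ [hd p]) ! Suc i) \<longleftrightarrow> R (p ! i) (p ! (Suc i mod length p))"
    if "i < length p" for i
  proof (cases "Suc i = length p")
    case True
    then show ?thesis using False that by (simp add: nth_append hd_conv_nth)
  next
    case F: False
    then show ?thesis using that by (simp add: nth_append)
  qed
  then show ?thesis by (simp add: cyclic_def successively_conv_nth False)
qed (simp add: cyclic_def)

lemma cyclic_conj: "cyclic R p \<Longrightarrow> cyclic S p \<Longrightarrow> cyclic (\<lambda>i j. R i j \<and> S i j) p"
  by (auto simp: cyclic_conv_nth)

lemma cyclic_mono_on:
  assumes "cyclic R p" and "\<And>i j. i \<in> set p \<Longrightarrow> j \<in> set p \<Longrightarrow> R i j \<Longrightarrow> S i j"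
  shows "cyclic S p"
  using assms by (auto simp: cyclic_conv_nth)

lemma cyclic_successor:
  assumes "cyclic (\<lambda>i j. j = f i) p" and "i \<in> set p"
  shows "f i \<in> set p"
  using assms by (auto simp: cyclic_conv_nth in_set_conv_nth) (metis mod_less_divisor length_pos_if_in_set nth_mem)

lemma cyclic_invariant:
  assumes "cyclic (\<lambda>i j. c j = c i) p" and "i \<in> set p"
  shows "c i = c (hd p)"
proof -
  have "successively (\<lambda>i j. c j = c i) q \<Longrightarrow> i \<in> set q \<Longrightarrow> c i = c (hd q)" for q
    by (induction q) (auto simp: successively_Cons)
  from this[of "p @ [hd p]"] show ?thesis using assms by (auto simp: cyclic_def)
qed

text \<open>Disjoint cyclic lists can be traversed by one successor function.\<close>

lemma cyclic_successor_function:
  assumes "distinct (concat ps)" and "[] \<notin> set ps"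
  shows "\<exists>f. \<forall>p\<in>set ps. cyclic (\<lambda>i j. j = f i) p"
  using assms
proof (induction ps)
  case (Cons p ps)
  then obtain f where f: "\<forall>p\<in>set ps. cyclic (\<lambda>i j. j = f i) p" by auto
  define s where "s = (\<lambda>i. the (map_of (zip p (rotate1 p)) i))"
  have s: "s (p ! i) = p ! (Suc i mod length p)" if "i < length p" for i
    using that Cons.prems by (simp add: s_def map_of_zip_nth nth_rotate1)
  define g where "g = (\<lambda>i. if i \<in> set p then s i else f i)"
  have "cyclic (\<lambda>i j. j = g i) p"
    using s Cons.prems by (auto simp: cyclic_conv_nth g_def)
  moreover have "cyclic (\<lambda>i j. j = g i) q" if "q \<in> set ps" for q
  proof (rule cyclic_mono_on)
    show "cyclic (\<lambda>i j. j = f i) q" using f that by blast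
    show "j = g i" if "i \<in> set q" "j = f i" for i j
      using that \<open>q \<in> set ps\<close> Cons.prems by (auto simp: g_def)
  qed
  ultimately show ?case by auto
qed auto

text \<open>Substituting a list for every entry turns a cyclic list into a longer one.\<close>

lemma cyclic_concat:
  assumes "cyclic S p"
    and seg: "\<And>i. i \<in> set p \<Longrightarrow> seg i \<noteq> [] \<and> successively R (seg i)"
    and link: "\<And>i j. i \<in> set p \<Longrightarrow> j \<in> set p \<Longrightarrow> S i j \<Longrightarrow> R (last (seg i)) (hd (seg j))"
  shows "cyclic R (concat (map seg p))"
proof -
  have *: "successively R (concat (map seg q)) \<and> (q \<noteq> [] \<longrightarrow> hd (concat (map seg q)) = hd (seg (hd q)))"
    if "set q \<subseteq> set p" "successively S q" for q
    using that
  proof (induction q)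
    case (Cons a q)
    show ?case
    proof (cases "q = []")
      case True
      then show ?thesis using seg Cons.prems by simp
    next
      case False
      have "hd q \<in> set q" using False by simp
      moreover have IH: "successively R (concat (map seg q))" "hd (concat (map seg q)) = hd (seg (hd q))"
        using Cons False by (auto simp: successively_Cons)
      moreover have "S a (hd q)" using Cons.prems False by (simp add: successively_Cons)
      ultimately show ?thesis using Cons.prems seg[of a] link[of a "hd q"]
        by (auto simp: successively_append_iff)
    qed
  qed simp
  have ne: "p \<noteq> []" and suc: "successively S (p @ [hd p])" using assms(1) by (auto simp: cyclic_def)
  let ?h = "seg (hd p)"
  have h: "?h \<noteq> []" "?h = hd ?h # tl ?h" using seg[of "hd p"] ne by auto
  have "successively R (concat (map seg (p @ [hd p])))"
    using *[of "p @ [hd p]"] suc ne by auto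
  then have "successively R ((concat (map seg p) @ [hd ?h]) @ tl ?h)"
    using h(2) by simp
  then have "successively R (concat (map seg p) @ [hd ?h])"
    by (simp only: successively_append_iff)
  moreover have "hd (concat (map seg p)) = hd ?h" using *[of p] suc ne
    by (auto simp: successively_append_iff)
  moreover have "concat (map seg p) \<noteq> []" using ne h(1) by (cases p) auto
  ultimately show ?thesis by (simp add: cyclic_def)
qed

section \<open>Covering a graph of bounded independence number by cycles\<close>

text \<open>
  This is a theorem of Posa: a graph without \<open>k + 1\<close> independent vertices is covered by \<open>k\<close>
  disjoint cycles. All neighbours of the first vertex \<open>v\<close> of a longest path lie on that path.
  The edge from \<open>v\<close> to the last of them closes a cycle through all the neighbours of \<open>v\<close>, so
  \<open>v\<close> can be added to any independent set that avoids this cycle; hence the independence number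
  drops when the cycle is removed. The relation is reflexive in order that single vertices
  count as cycles.\<close>

lemma cyclic_partition:
  assumes "finite I"
    and sym: "\<And>x y. R x y \<Longrightarrow> R y x"
    and refl: "\<And>x. x \<in> I \<Longrightarrow> R x x"
    and indep: "\<And>J. J \<subseteq> I \<Longrightarrow> (\<forall>x\<in>J. \<forall>y\<in>J. x \<noteq> y \<longrightarrow> \<not> R x y) \<Longrightarrow> card J \<le> k"
  shows "\<exists>ps. length ps \<le> k \<and> distinct (concat ps) \<and> set (concat ps) = I \<and> (\<forall>p\<in>set ps. cyclic R p)"
  using assms(1,3,4)
proof (induction k arbitrary: I)
  case 0
  have "I = {}"
  proof (rule ccontr)
    assume "I \<noteq> {}"
    then obtain x where "x \<in> I" by blast
    then show False using "0.prems"(3)[of "{x}"] by simp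
  qed
  then show ?case by (intro exI[of _ "[]"]) auto
next
  case (Suc k)
  show ?case
  proof (cases "I = {}")
    case True
    then show ?thesis by (intro exI[of _ "[]"]) auto
  next
    case False
    then obtain x0 where x0: "x0 \<in> I" by blast
    let ?P = "\<lambda>p. p \<noteq> [] \<and> distinct p \<and> set p \<subseteq> I \<and> successively R p"
    have "?P [x0]" using x0 by auto
    moreover have "\<forall>p. ?P p \<longrightarrow> length p \<le> card I"
      using Suc.prems(1) by (metis card_mono distinct_card)
    ultimately have "\<exists>p. ?P p \<and> (\<forall>q. ?P q \<longrightarrow> length q \<le> length p)"
      using ex_has_greatest_nat[of ?P "[x0]" length "Suc (card I)"] by (auto simp: less_Suc_eq_le)
    then obtain p where p: "?P p" and longest: "\<And>q. ?P q \<Longrightarrow> length q \<le> length p" by blast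
    define v where "v = hd p"
    have v: "v \<in> I" "v \<in> set p" using p by (auto simp: v_def)
    have nb: "u \<in> set p" if "u \<in> I" "R v u" for u
    proof (rule ccontr)
      assume "u \<notin> set p"
      then have "?P (u # p)" using p that sym by (auto simp: successively_Cons v_def)
      from longest[OF this] show False by simp
    qed
    have "\<exists>x\<in>set p. R v x" using v Suc.prems(2) by blast
    then obtain ys x zs where split: "p = ys @ x # zs" "R v x" and last: "\<forall>z\<in>set zs. \<not> R v z"
      by (rule split_list_last_propE)
    define C where "C = ys @ [x]"
    have C: "C \<noteq> []" "p = C @ zs" "hd C = v" "distinct C" "set C \<subseteq> I"
      using split p by (auto simp: C_def v_def hd_append)
    have "successively R C" using p C(2) by (simp add: successively_append_iff)
    then have cyc: "cyclic R C"
      using C(1,3) split(2) sym by (auto simp: cyclic_def successively_append_iff C_def)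
    have nbC: "u \<in> set C" if "u \<in> I" "R v u" for u
      using nb[OF that] last that C(2) by auto
    have vC: "v \<in> set C" using C(1,3) by (metis hd_in_set)
    have "\<exists>ps. length ps \<le> k \<and> distinct (concat ps) \<and> set (concat ps) = I - set C \<and> (\<forall>p\<in>set ps. cyclic R p)"
    proof (rule Suc.IH)
      fix J assume J: "J \<subseteq> I - set C" "\<forall>x\<in>J. \<forall>y\<in>J. x \<noteq> y \<longrightarrow> \<not> R x y"
      have "card (insert v J) \<le> Suc k"
      proof (rule Suc.prems(3))
        show "insert v J \<subseteq> I" using J v by auto
        show "\<forall>x\<in>insert v J. \<forall>y\<in>insert v J. x \<noteq> y \<longrightarrow> \<not> R x y"
          using J nbC sym by blast
      qed
      moreover have "v \<notin> J" using J vC by auto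
      moreover have "finite J" using J Suc.prems(1) by (meson finite_Diff finite_subset)
      ultimately show "card J \<le> k" by simp
    qed (use Suc.prems in auto)
    then obtain ps where "length ps \<le> k" "distinct (concat ps)" "set (concat ps) = I - set C"
      "\<forall>p\<in>set ps. cyclic R p" by blast
    then show ?thesis using C cyc by (intro exI[of _ "C # ps"]) auto
  qed
qed

section \<open>Linking large subsets of a small ground set\<close>

lemma card_mult_le_card_Union:
  assumes "finite J" and "\<And>i. i \<in> J \<Longrightarrow> finite (B i) \<and> b \<le> card (B i)"
    and "\<And>i j. i \<in> J \<Longrightarrow> j \<in> J \<Longrightarrow> i \<noteq> j \<Longrightarrow> card (B i \<inter> B j) \<le> d"
  shows "card J * b \<le> card (\<Union>i\<in>J. B i) + (card J)\<^sup>2 * d"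
  using assms
proof (induction J)
  case (insert x J)
  let ?U = "\<Union>i\<in>J. B i"
  have IH: "card J * b \<le> card ?U + (card J)\<^sup>2 * d" using insert by auto
  have fin: "finite ?U" "finite (B x)" using insert by auto
  have "card (B x \<inter> ?U) = card (\<Union>i\<in>J. B x \<inter> B i)" by (rule arg_cong[where f = card]) auto
  also have "\<dots> \<le> (\<Sum>i\<in>J. card (B x \<inter> B i))" by (rule card_UN_le) (use insert in auto)
  also have "\<dots> \<le> card J * d"
    using sum_bounded_above[of J "\<lambda>i. card (B x \<inter> B i)" d] insert by auto
  finally have "card (B x \<inter> ?U) \<le> card J * d" .
  moreover have "card (B x) + card ?U = card (B x \<union> ?U) + card (B x \<inter> ?U)"
    by (rule card_Un_Int[OF fin(2) fin(1)])
  moreover have "b \<le> card (B x)" using insert by auto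
  ultimately have "card J * b + b \<le> card (B x \<union> ?U) + card J * d + (card J)\<^sup>2 * d"
    using IH by linarith
  moreover have "(Suc (card J))\<^sup>2 * d = (card J)\<^sup>2 * d + 2 * (card J * d) + d"
    by (simp add: power2_eq_square algebra_simps)
  ultimately show ?case using insert by simp
qed simp

lemma distinct_representatives:
  assumes "finite I" and "\<And>i. i \<in> I \<Longrightarrow> card I \<le> card (A i)"
  shows "\<exists>f. inj_on f I \<and> (\<forall>i\<in>I. f i \<in> A i)"
  using assms
proof (induction I)
  case (insert x I)
  then obtain f where f: "inj_on f I" "\<forall>i\<in>I. f i \<in> A i" by fastforce
  have "card (f ` I) < card (A x)" using insert card_image_le[of I f] by fastforce
  then have "\<not> A x \<subseteq> f ` I" using insert(1) by (meson card_mono finite_imageI not_le)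
  then obtain a where "a \<in> A x" "a \<notin> f ` I" by blast
  then show ?case using f insert(2) by (intro exI[of _ "f(x := a)"]) (auto simp: inj_on_def)
qed simp

text \<open>
  Each index \<open>i\<close> owns a colour \<open>c i\<close> and a positive proportion \<open>B i\<close> of the ground set \<open>X\<close>, and
  no point of \<open>X\<close> meets more than \<open>D\<close> of the colours of the indices owning it. Join two indices
  of the same colour if their sets have a large intersection. In the ground set of all pairs
  (point, colour at that point), of size at most \<open>D * card X\<close>, every index owns a positive
  proportion and indices that are not joined own almost disjoint sets, so only boundedly many of
  them are pairwise not joined. Thus Posa's theorem arranges the indices into boundedly many
  cyclic lists. As there are few indices, every index can moreover be given a private point
  \<open>z i\<close> common to \<open>B i\<close> and the set of its successor, and another private point \<open>w i\<close> of \<open>B i\<close>.\<close>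

lemma linking:
  fixes c :: "'i \<Rightarrow> 'c" and B :: "'i \<Rightarrow> 'a set"
  assumes fin: "finite I" "finite X"
    and sub: "\<And>i. i \<in> I \<Longrightarrow> B i \<subseteq> X"
    and large: "\<And>i. i \<in> I \<Longrightarrow> card X \<le> k * card (B i)"
    and loc: "\<And>x. x \<in> X \<Longrightarrow> card (c ` {i \<in> I. x \<in> B i}) \<le> D"
    and few: "2 * k * (D * k + 1)\<^sup>2 * card I < card X"
  obtains ps :: "'i list list" and f z w where
    "length ps \<le> D * k" "distinct (concat ps)" "set (concat ps) = I"
    "\<forall>p\<in>set ps. cyclic (\<lambda>i j. j = f i) p"
    "\<forall>i\<in>I. f i \<in> I \<and> c (f i) = c i \<and> z i \<in> B i \<inter> B (f i) \<and> w i \<in> B i"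
    "inj_on z I" "inj_on w I" "z ` I \<inter> w ` I = {}"
proof -
  define d where "d = 2 * card I"
  define R where "R = (\<lambda>i j. c i = c j \<and> d \<le> card (B i \<inter> B j))"
  have big: "(D * k + 1)\<^sup>2 * d < card (B i)" if "i \<in> I" for i
  proof -
    have "k * ((D * k + 1)\<^sup>2 * d) = 2 * k * (D * k + 1)\<^sup>2 * card I" by (simp add: d_def)
    then have "k * ((D * k + 1)\<^sup>2 * d) < k * card (B i)"
      using few large[OF that] by linarith
    then show ?thesis by (simp only: mult_less_cancel1)
  qed
  have ge_d: "d \<le> card (B i)" if "i \<in> I" for i
  proof -
    have "1 * d \<le> (D * k + 1)\<^sup>2 * d" by (intro mult_right_mono) auto
    then show ?thesis using big[OF that] by linarith
  qed
  have finB: "finite (B i)" if "i \<in> I" for i using fin sub that by (meson finite_subset)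
  have "\<exists>ps. length ps \<le> D * k \<and> distinct (concat ps) \<and> set (concat ps) = I \<and> (\<forall>p\<in>set ps. cyclic R p)"
  proof (rule cyclic_partition)
    fix J assume J: "J \<subseteq> I" "\<forall>x\<in>J. \<forall>y\<in>J. x \<noteq> y \<longrightarrow> \<not> R x y"
    show "card J \<le> D * k"
    proof (rule ccontr)
      assume "\<not> card J \<le> D * k"
      then obtain J' where J': "J' \<subseteq> J" "card J' = D * k + 1"
        by (metis Suc_eq_plus1 not_less_eq_eq obtain_subset_with_card_n)
      have finJ: "finite J'" using J' by (metis Suc_eq_plus1 card.infinite nat.distinct(1))
      have inI: "i \<in> I" if "i \<in> J'" for i using that J J' by auto
      define B' where "B' = (\<lambda>i. B i \<times> {c i})"
      define \<Omega> where "\<Omega> = (SIGMA x:X. c ` {i \<in> I. x \<in> B i})"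
      have cardB': "card (B' i) = card (B i)" for i by (simp add: B'_def card_cartesian_product)
      have "finite \<Omega>" using fin by (auto simp: \<Omega>_def)
      have \<Omega>: "card \<Omega> \<le> D * card X"
        using fin sum_bounded_above[of X "\<lambda>x. card (c ` {i \<in> I. x \<in> B i})" D] loc
        by (simp add: \<Omega>_def mult.commute)
      define b where "b = Min ((\<lambda>i. card (B i)) ` J')"
      have ne: "J' \<noteq> {}" using J' by auto
      then have "b \<in> (\<lambda>i. card (B i)) ` J'" unfolding b_def using finJ by (intro Min_in) auto
      then obtain i0 where i0: "i0 \<in> J'" "b = card (B i0)" by auto
      have b_le: "b \<le> card (B i)" if "i \<in> J'" for i
        unfolding b_def using finJ that by (intro Min_le) auto
      have "card J' * b \<le> card (\<Union>i\<in>J'. B' i) + (card J')\<^sup>2 * d"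
      proof (rule card_mult_le_card_Union[OF finJ])
        fix i assume "i \<in> J'"
        then show "finite (B' i) \<and> b \<le> card (B' i)"
          using finB[OF inI] b_le cardB' by (auto simp: B'_def)
      next
        fix i j assume ij: "i \<in> J'" "j \<in> J'" "i \<noteq> j"
        then have n: "\<not> R i j" using J J' by auto
        show "card (B' i \<inter> B' j) \<le> d"
        proof (cases "c i = c j")
          case True
          then have "B' i \<inter> B' j = (B i \<inter> B j) \<times> {c i}" by (auto simp: B'_def)
          then show ?thesis using n True by (simp add: R_def card_cartesian_product)
        next
          case False
          then have "B' i \<inter> B' j = {}" by (auto simp: B'_def)
          then show ?thesis by simp
        qed
      qed
      moreover have "card (\<Union>i\<in>J'. B' i) \<le> card \<Omega>"
        using \<open>finite \<Omega>\<close> sub inI by (intro card_mono) (auto simp: B'_def \<Omega>_def)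
      moreover have "D * card X \<le> D * k * b"
        using large[OF inI[OF i0(1)]] i0(2) by (simp add: mult.assoc)
      ultimately have "(D * k + 1) * b \<le> D * k * b + (D * k + 1)\<^sup>2 * d"
        using \<Omega> unfolding J'(2) by linarith
      then have "b \<le> (D * k + 1)\<^sup>2 * d" by (simp add: algebra_simps)
      then show False using big[OF inI[OF i0(1)]] i0(2) by simp
    qed
  qed (use fin ge_d in \<open>auto simp: R_def Int_commute\<close>)
  then obtain ps where ps: "length ps \<le> D * k" "distinct (concat ps)" "set (concat ps) = I"
    "\<And>p. p \<in> set ps \<Longrightarrow> cyclic R p" by blast
  then obtain f where f: "\<And>p. p \<in> set ps \<Longrightarrow> cyclic (\<lambda>i j. j = f i) p"
    using cyclic_successor_function[of ps] by (metis cyclic_def)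
  have fI: "f i \<in> I \<and> R i (f i)" if "i \<in> I" for i
  proof -
    have "i \<in> set (concat ps)" using that ps(3) by simp
    then obtain p where p: "p \<in> set ps" "i \<in> set p" by auto
    have "cyclic (\<lambda>i j. R i j \<and> j = f i) p" using ps(4) f p by (intro cyclic_conj) auto
    then have "R i (f i)" using p by (auto simp: cyclic_conv_nth in_set_conv_nth)
    moreover have "f i \<in> I" using cyclic_successor[OF f] p ps(3) by auto
    ultimately show ?thesis by blast
  qed
  define A where "A = (\<lambda>(i, s). if s then B i \<inter> B (f i) else B i)"
  have "\<exists>g. inj_on g (I \<times> (UNIV :: bool set)) \<and> (\<forall>j\<in>I \<times> UNIV. g j \<in> A j)"
  proof (rule distinct_representatives)
    fix j assume j: "j \<in> I \<times> (UNIV :: bool set)"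
    have "card (I \<times> (UNIV :: bool set)) = d" by (simp add: card_cartesian_product d_def)
    then show "card (I \<times> (UNIV :: bool set)) \<le> card (A j)"
      using j fI ge_d by (cases j) (simp add: A_def R_def)
  qed (use fin in simp)
  then obtain g where g: "inj_on g (I \<times> (UNIV :: bool set))" "\<And>i s. i \<in> I \<Longrightarrow> g (i, s) \<in> A (i, s)"
    by auto
  show thesis
  proof (rule that[OF ps(1-3)])
    show "\<forall>p\<in>set ps. cyclic (\<lambda>i j. j = f i) p" using f by blast
    show "\<forall>i\<in>I. f i \<in> I \<and> c (f i) = c i \<and> g (i, True) \<in> B i \<inter> B (f i) \<and> g (i, False) \<in> B i"
    proof
      fix i assume i: "i \<in> I"
      show "f i \<in> I \<and> c (f i) = c i \<and> g (i, True) \<in> B i \<inter> B (f i) \<and> g (i, False) \<in> B i"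
        using fI[OF i] g(2)[OF i, of True] g(2)[OF i, of False] by (simp add: R_def A_def)
    qed
    show "inj_on (\<lambda>i. g (i, True)) I" "inj_on (\<lambda>i. g (i, False)) I"
      using g(1) by (auto simp: inj_on_def)
    have "g (i, True) \<noteq> g (j, False)" if "i \<in> I" "j \<in> I" for i j
      using inj_onD[OF g(1), of "(i, True)" "(j, False)"] that by blast
    then show "(\<lambda>i. g (i, True)) ` I \<inter> (\<lambda>i. g (i, False)) ` I = {}" by blast
  qed
qed

section \<open>Partitions into monochromatic cycles\<close>

abbreviation (input) cycle_partition :: "('a set \<Rightarrow> 'c) \<Rightarrow> 'a set \<Rightarrow> nat \<Rightarrow> bool" where
  "cycle_partition \<chi> A k \<equiv> partitioned_by_mono_cycles A (complete_edges A) \<chi> k"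

lemma cycle_partition_empty: "cycle_partition \<chi> {} 0"
  unfolding partitioned_by_mono_cycles_def
  by (intro exI[of _ "{}"]) (auto simp: disjoint_family_on_def)

lemma cycle_partition_mono: "cycle_partition \<chi> A k \<Longrightarrow> k \<le> l \<Longrightarrow> cycle_partition \<chi> A l"
  unfolding partitioned_by_mono_cycles_def by (elim exE, rule exI, elim conjE, intro conjI) auto

lemma cycle_partition_Un:
  assumes "cycle_partition \<chi> A k" "cycle_partition \<chi> B l" "A \<inter> B = {}"
  shows "cycle_partition \<chi> (A \<union> B) (k + l)"
proof -
  obtain \<C> where C: "finite \<C>" "card \<C> \<le> k" "disjoint_family_on set \<C>" "(\<Union>vs\<in>\<C>. set vs) = A"
    "\<And>vs. vs \<in> \<C> \<Longrightarrow> is_cycle A (complete_edges A) vs \<and> monochromatic \<chi> vs"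
    using assms(1) unfolding partitioned_by_mono_cycles_def by blast
  obtain \<D> where D: "finite \<D>" "card \<D> \<le> l" "disjoint_family_on set \<D>" "(\<Union>vs\<in>\<D>. set vs) = B"
    "\<And>vs. vs \<in> \<D> \<Longrightarrow> is_cycle B (complete_edges B) vs \<and> monochromatic \<chi> vs"
    using assms(2) unfolding partitioned_by_mono_cycles_def by blast
  have cyc: "is_cycle V (complete_edges V) vs"
    if "is_cycle U (complete_edges U) vs" "U \<subseteq> V" for U V :: "'a set" and vs
  proof -
    have "complete_edges U \<subseteq> complete_edges V" using that(2) by (auto simp: complete_edges_def)
    then show ?thesis using that by (auto simp: is_cycle_def)
  qed
  have "disjoint_family_on set (\<C> \<union> \<D>)"
    unfolding disjoint_family_on_def
  proof (intro ballI impI)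
    fix p q assume "p \<in> \<C> \<union> \<D>" "q \<in> \<C> \<union> \<D>" "p \<noteq> q"
    then consider "p \<in> \<C>" "q \<in> \<C>" | "p \<in> \<D>" "q \<in> \<D>" | "p \<in> \<C>" "q \<in> \<D>" | "p \<in> \<D>" "q \<in> \<C>"
      by blast
    then show "set p \<inter> set q = {}"
    proof cases
      case 1
      then show ?thesis using C(3) \<open>p \<noteq> q\<close> by (simp add: disjoint_family_on_def)
    next
      case 2
      then show ?thesis using D(3) \<open>p \<noteq> q\<close> by (simp add: disjoint_family_on_def)
    next
      case 3
      then have "set p \<subseteq> A" "set q \<subseteq> B" using C(4) D(4) by auto
      then show ?thesis using assms(3) by blast
    next
      case 4
      then have "set p \<subseteq> B" "set q \<subseteq> A" using C(4) D(4) by auto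
      then show ?thesis using assms(3) by blast
    qed
  qed
  moreover have "card (\<C> \<union> \<D>) \<le> k + l" using card_Un_le[of \<C> \<D>] C(2) D(2) by linarith
  ultimately show ?thesis
    unfolding partitioned_by_mono_cycles_def
  proof (intro exI[of _ "\<C> \<union> \<D>"] conjI ballI)
    fix p assume "p \<in> \<C> \<union> \<D>"
    then show "is_cycle (A \<union> B) (complete_edges (A \<union> B)) p" "monochromatic \<chi> p"
      using C(5) D(5) cyc[of A p "A \<union> B"] cyc[of B p "A \<union> B"] by auto
  qed (use C(1,4) D(1,4) in auto)
qed

text \<open>A single vertex \<open>v\<close> is admitted here, with \<open>c\<close> the value of the colouring at \<open>{v}\<close>.\<close>

lemma cycle_partition_cyclic:
  assumes "distinct p" and cyc: "cyclic (\<lambda>u v. \<chi> {u, v} = c) p"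
  shows "cycle_partition \<chi> (set p) 1"
proof -
  have edge: "\<chi> e = c \<and> e \<in> complete_edges (set p)" if "e \<in> cycle_edges p" for e
  proof -
    have len: "1 < length p" using that by (cases "length p \<le> 1") (auto simp: cycle_edges_def)
    then have "e \<in> {{p ! i, p ! (Suc i mod length p)} | i. i < length p}"
      using that by (simp add: cycle_edges_def)
    then obtain i where i: "i < length p" "e = {p ! i, p ! (Suc i mod length p)}" by blast
    let ?j = "Suc i mod length p"
    have j: "?j < length p" using len by (intro mod_less_divisor) auto
    have "?j \<noteq> i"
    proof (cases "Suc i = length p")
      case True
      then show ?thesis using len by simp
    next
      case False
      then show ?thesis using i by simp
    qed
    then have "p ! i \<noteq> p ! ?j" using assms(1) i j by (simp add: nth_eq_iff_index_eq)
    moreover have "\<chi> e = c" using cyc i by (simp add: cyclic_conv_nth)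
    moreover have "p ! i \<in> set p" "p ! ?j \<in> set p" using i j by auto
    ultimately show ?thesis using i(2) unfolding complete_edges_def by blast
  qed
  then have "is_cycle (set p) (complete_edges (set p)) p" "monochromatic \<chi> p"
    using assms(1) by (auto simp: is_cycle_def monochromatic_def)
  then show ?thesis
    unfolding partitioned_by_mono_cycles_def
    by (intro exI[of _ "{p}"]) (auto simp: disjoint_family_on_def)
qed

lemma cycle_partition_singletons: "finite A \<Longrightarrow> cycle_partition \<chi> A (card A)"
proof (induction A rule: finite_induct)
  case empty
  show ?case using cycle_partition_empty by simp
next
  case (insert x A)
  have "cycle_partition \<chi> (set [x]) 1" 
    by (rule cycle_partition_cyclic[where c = "\<chi> {x}"]) (auto simp: cyclic_def)
  from cycle_partition_Un[OF this insert.IH] insert.hyps show ?case by simp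
qed

lemma cycle_partition_UN:
  assumes "finite I" and "\<And>i. i \<in> I \<Longrightarrow> cycle_partition \<chi> (A i) k"
    and "\<And>i j. i \<in> I \<Longrightarrow> j \<in> I \<Longrightarrow> i \<noteq> j \<Longrightarrow> A i \<inter> A j = {}"
  shows "cycle_partition \<chi> (\<Union>i\<in>I. A i) (card I * k)"
  using assms
proof (induction I rule: finite_induct)
  case empty
  show ?case using cycle_partition_empty by simp
next
  case (insert x I)
  have "A x \<inter> (\<Union>i\<in>I. A i) = {}" using insert.prems(2) insert.hyps(2) by fastforce
  moreover have "cycle_partition \<chi> (\<Union>i\<in>I. A i) (card I * k)" "cycle_partition \<chi> (A x) k"
    using insert by auto
  ultimately show ?case using cycle_partition_Un[where \<chi> = \<chi> and A = "A x" and k = k] insert.hyps by simp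
qed

text \<open>
  Replacing each index by a monochromatic path turns a partition of the indices into cyclic lists
  into a partition of all the vertices on these paths into monochromatic cycles.\<close>

lemma cycle_partition_segments:
  fixes seg :: "'i \<Rightarrow> 'a list"
  assumes "distinct (concat ps)"
    and "\<And>p. p \<in> set ps \<Longrightarrow> cyclic (\<lambda>i j. j = f i) p"
    and "\<And>i. i \<in> set (concat ps) \<Longrightarrow> seg i \<noteq> [] \<and> distinct (seg i) \<and> c (f i) = c i
      \<and> successively (\<lambda>u v. \<chi> {u, v} = c i) (seg i) \<and> \<chi> {last (seg i), hd (seg (f i))} = c i"
    and "\<And>i j. i \<in> set (concat ps) \<Longrightarrow> j \<in> set (concat ps) \<Longrightarrow> i \<noteq> j \<Longrightarrow> set (seg i) \<inter> set (seg j) = {}"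
  shows "cycle_partition \<chi> (\<Union>i\<in>set (concat ps). set (seg i)) (length ps)"
  using assms
proof (induction ps)
  case Nil
  show ?case using cycle_partition_empty by simp
next
  case (Cons p ps)
  let ?A = "\<Union>i\<in>set p. set (seg i)" and ?B = "\<Union>i\<in>set (concat ps). set (seg i)"
  have "cycle_partition \<chi> ?B (length ps)"
    using Cons.prems by (intro Cons.IH) auto
  moreover have "cycle_partition \<chi> (set (concat (map seg p))) 1"
  proof (rule cycle_partition_cyclic)
    have p: "cyclic (\<lambda>i j. j = f i) p" using Cons.prems by simp
    have "cyclic (\<lambda>i j. c j = c i) p"
      using p by (rule cyclic_mono_on) (use Cons.prems in auto)
    then have c: "c i = c (hd p)" if "i \<in> set p" for i using cyclic_invariant[of c p] that by blast
    show "cyclic (\<lambda>u v. \<chi> {u, v} = c (hd p)) (concat (map seg p))"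
    proof (rule cyclic_concat[OF p])
      fix i assume i: "i \<in> set p"
      then show "seg i \<noteq> [] \<and> successively (\<lambda>u v. \<chi> {u, v} = c (hd p)) (seg i)"
        using Cons.prems(3)[of i] c[OF i] by simp
      fix j assume "j = f i"
      then show "\<chi> {last (seg i), hd (seg j)} = c (hd p)"
        using Cons.prems(3)[of i] c[OF i] i by simp
    qed
    have "distinct p" using Cons.prems(1) by simp
    moreover have "\<And>i. i \<in> set p \<Longrightarrow> distinct (seg i)" using Cons.prems(3) by simp
    moreover have "\<And>i j. i \<in> set p \<Longrightarrow> j \<in> set p \<Longrightarrow> i \<noteq> j \<Longrightarrow> set (seg i) \<inter> set (seg j) = {}"
      using Cons.prems(4) by simp
    ultimately show "distinct (concat (map seg p))"
    proof (induction p)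
      case (Cons a p)
      have "set (seg a) \<inter> set (seg i) = {}" if "i \<in> set p" for i
        using Cons.prems that by (intro Cons.prems(3)) auto
      then show ?case using Cons by auto
    qed simp
  qed
  moreover have "?A \<inter> ?B = {}"
  proof -
    have "set (seg i) \<inter> set (seg j) = {}" if "i \<in> set p" "j \<in> set (concat ps)" for i j
      using Cons.prems(1) that by (intro Cons.prems(4)) auto
    then show ?thesis by blast
  qed
  ultimately have "cycle_partition \<chi> (?A \<union> ?B) (1 + length ps)"
    using cycle_partition_Un[where \<chi> = \<chi> and A = ?A and k = 1 and B = ?B and l = "length ps"] by simp
  moreover have "?A \<union> ?B = (\<Union>i\<in>set (concat (p # ps)). set (seg i))" by auto
  ultimately show ?case by simp
qed

lemma popular_value:
  assumes "finite X" "finite C" "card C \<le> k" "f ` X \<subseteq> C"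
  shows "\<exists>c. card X \<le> k * card {x \<in> X. f x = c}"
proof (rule ccontr)
  assume "\<nexists>c. card X \<le> k * card {x \<in> X. f x = c}"
  then have less: "k * card {x \<in> X. f x = c} < card X" for c by (simp add: not_le)
  have "card X = card (\<Union>c\<in>C. {x \<in> X. f x = c})" using assms by (intro arg_cong[where f = card]) auto
  also have "\<dots> \<le> (\<Sum>c\<in>C. card {x \<in> X. f x = c})" by (rule card_UN_le[OF assms(2)])
  finally have le: "card X \<le> (\<Sum>c\<in>C. card {x \<in> X. f x = c})" .
  have "C \<noteq> {}" using less[of undefined] le by auto
  then have "(\<Sum>c\<in>C. k * card {x \<in> X. f x = c}) < (\<Sum>c\<in>C. card X)"
    using less assms(2) by (intro sum_strict_mono) auto
  then have "k * (\<Sum>c\<in>C. card {x \<in> X. f x = c}) < card C * card X" by (simp add: sum_distrib_left)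
  also have "\<dots> \<le> k * card X" using assms(3) by simp
  also have "\<dots> \<le> k * (\<Sum>c\<in>C. card {x \<in> X. f x = c})" using le by simp
  finally show False by simp
qed

text \<open>
  In a cycle that alternates between \<open>Y\<close> and \<open>X\<close>, consecutive vertices of \<open>Y\<close> are joined through
  a common neighbour in \<open>X\<close>. With the sets \<open>B\<close> of neighbours in a frequent colour,
  the linking lemma therefore covers a set \<open>Y\<close> that is small compared to \<open>X\<close>.\<close>

lemma cover_small_set:
  fixes \<chi> :: "'a set \<Rightarrow> 'c"
  assumes fin: "finite X" "finite Y" and disj: "X \<inter> Y = {}"
    and loc: "\<And>x. x \<in> X \<Longrightarrow> card ((\<lambda>y. \<chi> {y, x}) ` Y) \<le> D"
    and maj: "\<And>y. y \<in> Y \<Longrightarrow> \<exists>c. card X \<le> k * card {x \<in> X. \<chi> {y, x} = c}"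
    and few: "2 * k * (D * k + 1)\<^sup>2 * card Y < card X"
  obtains A where "Y \<subseteq> A" "A \<subseteq> Y \<union> X" "card A \<le> 2 * card Y" "cycle_partition \<chi> A (D * k)"
proof -
  have "\<exists>c. \<forall>y\<in>Y. card X \<le> k * card {x \<in> X. \<chi> {y, x} = c y}"
    using maj by (intro bchoice) blast
  then obtain c where c: "\<And>y. y \<in> Y \<Longrightarrow> card X \<le> k * card {x \<in> X. \<chi> {y, x} = c y}" by blast
  define B where "B = (\<lambda>y. {x \<in> X. \<chi> {y, x} = c y})"
  have sub: "B y \<subseteq> X" if "y \<in> Y" for y by (auto simp: B_def)
  have large: "card X \<le> k * card (B y)" if "y \<in> Y" for y using c[OF that] by (simp add: B_def)
  have "card (c ` {y \<in> Y. x \<in> B y}) \<le> D" if "x \<in> X" for x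
  proof -
    have "c ` {y \<in> Y. x \<in> B y} \<subseteq> (\<lambda>y. \<chi> {y, x}) ` Y" by (auto simp: B_def intro!: image_eqI[OF sym])
    then show ?thesis using loc[OF that] fin(2) by (meson card_mono finite_imageI order_trans)
  qed
  note linked = linking[OF fin(2) fin(1) sub large this few]
  obtain ps f z and w :: "'a \<Rightarrow> 'a"
    where ps: "length ps \<le> D * k" "distinct (concat ps)" "set (concat ps) = Y"
    and f: "\<forall>p\<in>set ps. cyclic (\<lambda>i j. j = f i) p"
    and z': "\<forall>y\<in>Y. f y \<in> Y \<and> c (f y) = c y \<and> z y \<in> B y \<inter> B (f y) \<and> w y \<in> B y"
    and inj: "inj_on z Y" "inj_on w Y" "z ` Y \<inter> w ` Y = {}"
    by (rule linked; (assumption | (rule that; assumption)))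
  have z: "f y \<in> Y \<and> c (f y) = c y \<and> z y \<in> B y \<inter> B (f y)" if "y \<in> Y" for y using z' that by blast
  let ?seg = "\<lambda>y. [y, z y]"
  have zX: "z ` Y \<subseteq> X" using z by (auto simp: B_def)
  have zc: "\<chi> {y, z y} = c y" "\<chi> {z y, f y} = c y" if "y \<in> Y" for y
    using z[OF that] by (auto simp: B_def insert_commute)
  have "cycle_partition \<chi> (\<Union>y\<in>set (concat ps). set (?seg y)) (length ps)"
  proof (rule cycle_partition_segments[OF ps(2), where c = c and f = f])
    fix y assume "y \<in> set (concat ps)"
    then have y: "y \<in> Y" by (simp only: ps(3))
    then have "y \<noteq> z y" using zX disj by blast
    then show "?seg y \<noteq> [] \<and> distinct (?seg y) \<and> c (f y) = c y \<and>
      successively (\<lambda>u v. \<chi> {u, v} = c y) (?seg y) \<and> \<chi> {last (?seg y), hd (?seg (f y))} = c y"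
      using z[OF y] zc[OF y] by simp
  next
    fix x y assume "x \<in> set (concat ps)" "y \<in> set (concat ps)" and "x \<noteq> y"
    then have "x \<in> Y" "y \<in> Y" by (simp_all only: ps(3))
    moreover from this have "z x \<noteq> z y" using inj(1) \<open>x \<noteq> y\<close> by (auto simp: inj_on_def)
    moreover have "z x \<noteq> y" "z y \<noteq> x" using zX disj \<open>x \<in> Y\<close> \<open>y \<in> Y\<close> by auto
    ultimately show "set (?seg x) \<inter> set (?seg y) = {}" using \<open>x \<noteq> y\<close> by auto
  qed (use f in auto)
  moreover have "(\<Union>y\<in>set (concat ps). set (?seg y)) = Y \<union> z ` Y" unfolding ps(3) by auto
  ultimately have "cycle_partition \<chi> (Y \<union> z ` Y) (D * k)" using ps(1) cycle_partition_mono by metis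
  moreover have "card (Y \<union> z ` Y) \<le> 2 * card Y"
    using card_Un_le[of Y "z ` Y"] card_image_le[OF fin(2), of z] by linarith
  ultimately show thesis using zX by (intro that[of "Y \<union> z ` Y"]) auto
qed

section \<open>Local colourings\<close>

definition local_colouring :: "nat \<Rightarrow> ('a set \<Rightarrow> 'c) \<Rightarrow> 'a set \<Rightarrow> bool" where
  "local_colouring D \<chi> V \<longleftrightarrow> (\<forall>v\<in>V. card ((\<lambda>u. \<chi> {v, u}) ` (V - {v})) \<le> D)"

lemma local_colouring_card_image:
  assumes "local_colouring D \<chi> V" "finite V" "v \<in> V" "U \<subseteq> V - {v}"
  shows "card ((\<lambda>u. \<chi> {v, u}) ` U) \<le> D"
proof -
  have "card ((\<lambda>u. \<chi> {v, u}) ` U) \<le> card ((\<lambda>u. \<chi> {v, u}) ` (V - {v}))"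
    using assms by (intro card_mono) auto
  then show ?thesis using assms by (auto simp: local_colouring_def)
qed

lemma local_colouring_subset:
  assumes "local_colouring D \<chi> V" "finite V" "U \<subseteq> V"
  shows "local_colouring D \<chi> U"
  unfolding local_colouring_def
proof
  fix v assume "v \<in> U"
  then show "card ((\<lambda>u. \<chi> {v, u}) ` (U - {v})) \<le> D"
    using local_colouring_card_image[OF assms(1,2), of v "U - {v}"] assms(3) by auto
qed

lemma local_colouring_majority:
  assumes "local_colouring D \<chi> V" "finite V" "v \<in> V" "U \<subseteq> V - {v}"
  shows "\<exists>c. card U \<le> D * card {u \<in> U. \<chi> {v, u} = c}"
proof -
  have "finite U" using assms by (meson finite_Diff finite_subset)
  then show ?thesis
    using popular_value[of U "(\<lambda>u. \<chi> {v, u}) ` U" D] local_colouring_card_image[OF assms] by auto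
qed

lemma cover_local:
  assumes loc: "local_colouring D \<chi> V" and fin: "finite V"
    and sub: "X \<subseteq> V" "Y \<subseteq> V" "X \<inter> Y = {}" and few: "2 * D * (D * D + 1)\<^sup>2 * card Y < card X"
  obtains A where "Y \<subseteq> A" "A \<subseteq> Y \<union> X" "cycle_partition \<chi> A (D * D)"
proof (rule cover_small_set[where \<chi> = \<chi> and X = X and Y = Y and D = D and k = D])
  fix A assume "Y \<subseteq> A" "A \<subseteq> Y \<union> X" "cycle_partition \<chi> A (D * D)"
  then show thesis by (rule that)
next
  show "finite X" "finite Y" using fin sub by (auto intro: finite_subset)
  show "card ((\<lambda>y. \<chi> {y, x}) ` Y) \<le> D" if "x \<in> X" for x
  proof -
    have "(\<lambda>y. \<chi> {y, x}) ` Y = (\<lambda>y. \<chi> {x, y}) ` Y" by (simp add: insert_commute)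
    then show ?thesis using local_colouring_card_image[OF loc fin, of x Y] that sub by auto
  qed
  show "\<exists>c. card X \<le> D * card {x \<in> X. \<chi> {y, x} = c}" if "y \<in> Y" for y
    using sub that by (intro local_colouring_majority[OF loc fin]) auto
qed (use sub few in auto)

definition codegree :: "('a set \<Rightarrow> 'c) \<Rightarrow> 'a set \<Rightarrow> 'a \<Rightarrow> 'a \<Rightarrow> nat" where
  "codegree \<chi> V a b = card {x \<in> V - {a, b}. \<chi> {a, x} = \<chi> {a, b} \<and> \<chi> {b, x} = \<chi> {a, b}}"

text \<open>
  Choose vertices \<open>v\<^sub>1, v\<^sub>2, \<dots>\<close> greedily, each inside the neighbourhood of the previous one in
  its most frequent colour, so that the nested neighbourhoods shrink by constant factors only. All
  edges from \<open>v\<^sub>i\<close> to the later vertices and to the current neighbourhood \<open>U\<close> have one colour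
  \<open>c\<^sub>i\<close>, so all the \<open>c\<^sub>i\<close> lie in the palettes of the vertices of \<open>U\<close>. Hence a colour is repeated
  after at most \<open>D + 1\<close> steps, and then \<open>v\<^sub>i\<close> and \<open>v\<^sub>j\<close> with \<open>c\<^sub>i = c\<^sub>j\<close> and the whole current
  neighbourhood form monochromatic triangles. \<open>F\<close> is the set of colours chosen so far.\<close>

lemma large_codegree_aux:
  assumes fin: "finite V" and loc: "local_colouring D \<chi> V" and D: "D \<ge> 1" and L: "L \<ge> 1"
    and "U \<subseteq> V" "finite F" "\<forall>c\<in>F. \<exists>v\<in>V - U. \<forall>u\<in>U. \<chi> {v, u} = c"
    and "card F \<le> D" "L * (D + 1) ^ Suc (D - card F) \<le> card U"
  shows "\<exists>a\<in>V. \<exists>b\<in>V. a \<noteq> b \<and> L \<le> codegree \<chi> V a b"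
  using assms(5-)
proof (induction "D - card F" arbitrary: U F rule: less_induct)
  case less
  define M where "M = L * (D + 1) ^ (D - card F)"
  have M: "L \<le> M" "M * (D + 1) \<le> card U" using less.prems(5) by (auto simp: M_def algebra_simps)
  have finU: "finite U" using less.prems(1) fin by (rule finite_subset)
  have "U \<noteq> {}" using M L by auto
  then obtain u where u: "u \<in> U" by blast
  have "\<exists>c. card (U - {u}) \<le> D * card {x \<in> U - {u}. \<chi> {u, x} = c}"
    using u less.prems(1) by (intro local_colouring_majority[OF loc fin]) auto
  then obtain c where c: "card (U - {u}) \<le> D * card {x \<in> U - {u}. \<chi> {u, x} = c}" by blast
  define U' where "U' = {x \<in> U - {u}. \<chi> {u, x} = c}"
  have U': "M \<le> card U'"
  proof (rule ccontr)
    assume "\<not> M \<le> card U'"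
    then have "D * Suc (card U') \<le> D * M" by (intro mult_left_mono) auto
    moreover have "card U - 1 \<le> D * card U'" using c u finU by (simp add: U'_def)
    moreover have "M * (D + 1) = D * M + M" by simp
    ultimately show False using M L D by (simp add: algebra_simps)
  qed
  show ?case
  proof (cases "c \<in> F")
    case True
    then obtain v where v: "v \<in> V - U" "\<forall>u\<in>U. \<chi> {v, u} = c" using less.prems(3) by blast
    have "U' \<subseteq> {x \<in> V - {v, u}. \<chi> {v, x} = \<chi> {v, u} \<and> \<chi> {u, x} = \<chi> {v, u}}"
      using u v less.prems(1) by (auto simp: U'_def)
    then have "card U' \<le> codegree \<chi> V v u"
      unfolding codegree_def using fin by (intro card_mono) auto
    then have "L \<le> codegree \<chi> V v u" using M(1) U' by linarith
    moreover have "v \<in> V" "u \<in> V" "v \<noteq> u" using u v less.prems(1) by auto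
    ultimately show ?thesis by blast
  next
    case False
    have "U' \<noteq> {}" using U' M L by auto
    then obtain x where x: "x \<in> U'" by blast
    have xU: "x \<in> U" "x \<noteq> u" "\<chi> {x, u} = c" "x \<in> V"
      using x less.prems(1) by (auto simp: U'_def insert_commute[of x u])
    let ?P = "(\<lambda>v. \<chi> {x, v}) ` (V - {x})"
    have "c \<in> ?P" using xU u less.prems(1) by (intro image_eqI[where x = u]) auto
    moreover have "F \<subseteq> ?P"
    proof
      fix f assume "f \<in> F"
      then obtain v where v: "v \<in> V - U" "\<forall>u\<in>U. \<chi> {v, u} = f" using less.prems(3) by blast
      then have "f = \<chi> {x, v}" using xU(1) by (simp add: insert_commute[of x v])
      moreover have "v \<in> V - {x}" using v(1) xU(1) by auto
      ultimately show "f \<in> ?P" by (rule image_eqI)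
    qed
    ultimately have "insert c F \<subseteq> ?P" by (rule insert_subsetI)
    then have "card (insert c F) \<le> card ?P" by (rule card_mono[rotated]) (use fin in simp)
    also have "\<dots> \<le> D" using loc xU(4) by (simp add: local_colouring_def)
    finally have "card (insert c F) \<le> D" .
    then have card: "Suc (card F) \<le> D" "card (insert c F) = Suc (card F)"
      using False less.prems(2) by auto
    show ?thesis
    proof (rule less.hyps)
      show "D - card (insert c F) < D - card F" using card by simp
      show "U' \<subseteq> V" "finite (insert c F)" "card (insert c F) \<le> D"
        using less.prems card by (auto simp: U'_def)
      show "L * (D + 1) ^ Suc (D - card (insert c F)) \<le> card U'"
        using U' card by (simp add: M_def Suc_diff_Suc del: power_Suc)
      have "\<exists>v\<in>V - U'. \<forall>u\<in>U'. \<chi> {v, u} = f" if "f \<in> F" for f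
      proof -
        obtain v where "v \<in> V - U" "\<forall>u\<in>U. \<chi> {v, u} = f" using less.prems(3) \<open>f \<in> F\<close> by blast
        then show ?thesis by (intro bexI[of _ v]) (auto simp: U'_def)
      qed
      moreover have "u \<in> V - U'" "\<forall>x\<in>U'. \<chi> {u, x} = c" using u less.prems(1) by (auto simp: U'_def)
      ultimately show "\<forall>f\<in>insert c F. \<exists>v\<in>V - U'. \<forall>u\<in>U'. \<chi> {v, u} = f" by blast
    qed
  qed
qed

lemma large_codegree:
  assumes "finite V" "local_colouring D \<chi> V" "D \<ge> 1" "card V \<ge> (D + 1) ^ Suc D"
  obtains a b where "a \<in> V" "b \<in> V" "a \<noteq> b" "card V div (D + 1) ^ Suc D \<le> codegree \<chi> V a b"
proof -
  let ?L = "card V div (D + 1) ^ Suc D"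
  have "?L \<ge> 1" using assms(4) by (simp add: div_greater_zero_iff Suc_le_eq)
  then have "\<exists>a\<in>V. \<exists>b\<in>V. a \<noteq> b \<and> ?L \<le> codegree \<chi> V a b"
    using assms(4) by (intro large_codegree_aux[OF assms(1-3), where U = V and F = "{}"]) auto
  then show thesis using that by blast
qed

text \<open>Every half of the vertices still contains a pair of large codegree, so such pairs can be chosen
  disjointly until a positive proportion of the vertices is used up.\<close>

lemma disjoint_pairs_of_large_codegree:
  assumes fin: "finite V" and loc: "local_colouring D \<chi> V" and D: "D \<ge> 1"
    and card: "card V \<ge> 2 * (D + 1) ^ Suc D" and m: "4 * m \<le> card V"
  shows "\<exists>P. finite P \<and> card P = m \<and>
    (\<forall>(a, b)\<in>P. a \<in> V \<and> b \<in> V \<and> a \<noteq> b \<and> card V div (2 * (D + 1) ^ Suc D) \<le> codegree \<chi> V a b) \<and>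
    (\<forall>p\<in>P. \<forall>q\<in>P. p \<noteq> q \<longrightarrow> {fst p, snd p} \<inter> {fst q, snd q} = {})"
  using m
proof (induction m)
  case 0
  show ?case by (intro exI[of _ "{}"]) auto
next
  case (Suc m)
  let ?E = "(D + 1) ^ Suc D"
  let ?g = "\<lambda>a b. a \<in> V \<and> b \<in> V \<and> a \<noteq> b \<and> card V div (2 * ?E) \<le> codegree \<chi> V a b"
  obtain P where P: "finite P" "card P = m" "\<forall>(a, b)\<in>P. ?g a b"
    "\<forall>p\<in>P. \<forall>q\<in>P. p \<noteq> q \<longrightarrow> {fst p, snd p} \<inter> {fst q, snd q} = {}"
    using Suc by auto
  define Z where "Z = fst ` P \<union> snd ` P"
  have "card Z \<le> 2 * m"
    using card_Un_le[of "fst ` P" "snd ` P"] card_image_le[OF P(1), of fst] card_image_le[OF P(1), of snd] P(2)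
    unfolding Z_def by linarith
  then have "card V \<le> 2 * card (V - Z)"
    using Suc.prems diff_card_le_card_Diff[of Z V] P(1) unfolding Z_def by simp
  then have half: "card V div (2 * ?E) \<le> card (V - Z) div ?E"
    by (metis div_le_mono div_mult2_eq nonzero_mult_div_cancel_left zero_neq_numeral)
  have "?E \<le> card (V - Z)" using card \<open>card V \<le> 2 * card (V - Z)\<close> by linarith
  then obtain a b where ab: "a \<in> V - Z" "b \<in> V - Z" "a \<noteq> b" "card (V - Z) div ?E \<le> codegree \<chi> (V - Z) a b"
    using large_codegree[OF _ local_colouring_subset[OF loc fin] D, of "V - Z"] fin by auto
  have "codegree \<chi> (V - Z) a b \<le> codegree \<chi> V a b"
    unfolding codegree_def using fin by (intro card_mono) auto
  then have g: "?g a b" using ab half by auto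
  have disj: "{a, b} \<inter> {fst p, snd p} = {}" if "p \<in> P" for p
    using ab that by (auto simp: Z_def)
  then have "(a, b) \<notin> P" by fastforce
  show ?case
  proof (intro exI[of _ "insert (a, b) P"] conjI)
    show "card (insert (a, b) P) = Suc m" using P(1,2) \<open>(a, b) \<notin> P\<close> by simp
    show "\<forall>(a, b)\<in>insert (a, b) P. ?g a b" using P(3) g by blast
    show "\<forall>p\<in>insert (a, b) P. \<forall>q\<in>insert (a, b) P. p \<noteq> q \<longrightarrow> {fst p, snd p} \<inter> {fst q, snd q} = {}"
    proof (intro ballI impI)
      fix p q assume pq: "p \<in> insert (a, b) P" "q \<in> insert (a, b) P" "p \<noteq> q"
      then consider "p \<in> P" "q \<in> P" | "p = (a, b)" "q \<in> P" | "q = (a, b)" "p \<in> P" by blast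
      then show "{fst p, snd p} \<inter> {fst q, snd q} = {}"
      proof cases
        case 1
        then show ?thesis using P(4) pq(3) by blast
      next
        case 2
        then show ?thesis using disj[of q] by simp
      next
        case 3
        then show ?thesis using disj[of p] by (simp add: Int_commute)
      qed
    qed
  qed (use P(1) in simp)
qed

text \<open>
  The absorber consists of disjoint pairs \<open>(a, b)\<close> of large codegree, which the linking lemma
  arranges into monochromatic cycles \<open>\<dots> a b z a' b' z' \<dots>\<close> so that every pair has in addition
  a private vertex \<open>w\<close> that is joined to \<open>a\<close> and \<open>b\<close> in the colour of \<open>ab\<close>. Each of these
  vertices, independently of the others, may be inserted into its cycle or left out.\<close>

lemma absorber:
  assumes D: "D \<ge> 1"
  shows "\<exists>h N. \<forall>(\<chi> :: 'a set \<Rightarrow> 'c) V. finite V \<longrightarrow> local_colouring D \<chi> V \<longrightarrow> h \<le> card V \<longrightarrow>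
    (\<exists>X Q. X \<subseteq> V \<and> Q \<subseteq> V \<and> X \<inter> Q = {} \<and> card V \<le> 2 * h * card X \<and>
      (\<forall>W\<subseteq>X. cycle_partition \<chi> (Q \<union> W) N))"
proof -
  \<comment> \<open>With \<open>n = card V\<close>, pairs have codegree about \<open>n / E\<close>. Discarding the vertices of the pairs leaves at least \<open>n / k\<close> of it,
    and \<open>n / h\<close> pairs are few enough for the linking lemma.\<close>
  define E where "E = 2 * (D + 1) ^ Suc D"
  define k where "k = 4 * E"
  define s where "s = (D * k + 1)\<^sup>2"
  define h where "h = 8 * k * s"
  have "(D + 1) ^ Suc D \<ge> 1" by (rule one_le_power) simp
  then have E: "E \<ge> 2" unfolding E_def by linarith
  have s: "s \<ge> 1" unfolding s_def by simp
  have hE: "E \<le> h"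
  proof -
    have "E * 1 \<le> E * (32 * s)" using s by (intro mult_left_mono) auto
    then show ?thesis by (simp add: h_def k_def algebra_simps)
  qed
  have "\<exists>X Q. X \<subseteq> V \<and> Q \<subseteq> V \<and> X \<inter> Q = {} \<and> card V \<le> 2 * h * card X \<and>
      (\<forall>W\<subseteq>X. cycle_partition \<chi> (Q \<union> W) (D * k))"
    if fin: "finite V" and loc: "local_colouring D \<chi> V" and big: "h \<le> card V"
    for \<chi> :: "'a set \<Rightarrow> 'c" and V
  proof -
    define n where "n = card V"
    define m where "m = n div h"
    define L where "L = n div E"
    have hpos: "h > 0" using hE E by linarith
    have m1: "h * m \<le> n" unfolding m_def by (rule times_div_less_eq_dividend)
    have "m \<ge> 1" using big hpos by (simp add: m_def n_def div_greater_zero_iff Suc_le_eq)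
    then have m2: "n \<le> 2 * (h * m)"
    proof -
      have "n < h + h * m" unfolding m_def using hpos by (rule dividend_less_times_div)
      moreover have "h * 1 \<le> h * m" using \<open>m \<ge> 1\<close> by (intro mult_left_mono) auto
      ultimately show ?thesis by linarith
    qed
    have "n \<ge> E" using hE big by (simp add: n_def)
    then have "L \<ge> 1" using E by (simp add: L_def div_greater_zero_iff Suc_le_eq)
    have L: "n \<le> 2 * (E * L)"
    proof -
      have "n < E + E * L" unfolding L_def using E by (intro dividend_less_times_div) simp
      moreover have "E * 1 \<le> E * L" using \<open>L \<ge> 1\<close> by (intro mult_left_mono) auto
      ultimately show ?thesis by linarith
    qed
    define r where "r = E * s * m"
    have hm: "h * m = 32 * r" by (simp add: h_def k_def r_def)
    have Em: "E * m \<le> r"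
    proof -
      have "E * m * 1 \<le> E * m * s" using s by (intro mult_left_mono) auto
      then show ?thesis by (simp add: r_def algebra_simps)
    qed
    have mE: "2 * m \<le> E * m" using E by (intro mult_right_mono) auto
    have "n > 0" using \<open>n \<ge> E\<close> E by linarith
    have "4 * m \<le> card V" using m1 hm Em mE unfolding n_def by linarith
    moreover have "card V \<ge> 2 * (D + 1) ^ Suc D" using \<open>n \<ge> E\<close> unfolding E_def n_def .
    ultimately have "\<exists>P. finite P \<and> card P = m \<and>
      (\<forall>(a, b)\<in>P. a \<in> V \<and> b \<in> V \<and> a \<noteq> b \<and> L \<le> codegree \<chi> V a b) \<and>
      (\<forall>p\<in>P. \<forall>q\<in>P. p \<noteq> q \<longrightarrow> {fst p, snd p} \<inter> {fst q, snd q} = {})"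
      unfolding L_def n_def E_def by (intro disjoint_pairs_of_large_codegree[OF fin loc D])
    then obtain P where "finite P" "card P = m"
      and g: "\<forall>(a, b)\<in>P. a \<in> V \<and> b \<in> V \<and> a \<noteq> b \<and> L \<le> codegree \<chi> V a b"
      and disj': "\<forall>p\<in>P. \<forall>q\<in>P. p \<noteq> q \<longrightarrow> {fst p, snd p} \<inter> {fst q, snd q} = {}"
      by (elim exE conjE) (rule that)
    moreover have "fst p \<in> V \<and> snd p \<in> V \<and> fst p \<noteq> snd p \<and> L \<le> codegree \<chi> V (fst p) (snd p)"
      if "p \<in> P" for p using g that by (simp add: case_prod_unfold)
    ultimately have P: "finite P" "card P = m"
      "\<And>p. p \<in> P \<Longrightarrow> fst p \<in> V \<and> snd p \<in> V \<and> fst p \<noteq> snd p \<and> L \<le> codegree \<chi> V (fst p) (snd p)"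
      by simp_all
    have disj: "{fst p, snd p} \<inter> {fst q, snd q} = {}" if "p \<in> P" "q \<in> P" "p \<noteq> q" for p q
      using disj' that by blast
    define Z where "Z = fst ` P \<union> snd ` P"
    have ZV: "Z \<subseteq> V" using P(3) by (auto simp: Z_def)
    have finZ: "finite Z" using P(1) by (simp add: Z_def)
    have cardZ: "card Z \<le> 2 * m"
      using card_Un_le[of "fst ` P" "snd ` P"] card_image_le[OF P(1), of fst]
        card_image_le[OF P(1), of snd] P(2) unfolding Z_def by linarith
    define c where "c = (\<lambda>p. \<chi> {fst p, snd p})"
    define B where "B = (\<lambda>p. {x \<in> V - Z. \<chi> {fst p, x} = c p \<and> \<chi> {snd p, x} = c p})"
    have sub: "B p \<subseteq> V - Z" for p by (auto simp: B_def)
    have large: "card (V - Z) \<le> k * card (B p)" if "p \<in> P" for p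
    proof -
      let ?S = "{x \<in> V - {fst p, snd p}. \<chi> {fst p, x} = c p \<and> \<chi> {snd p, x} = c p}"
      have "?S - Z \<subseteq> B p" by (auto simp: B_def)
      then have "card (?S - Z) \<le> card (B p)" using fin by (intro card_mono) (auto simp: B_def)
      moreover have "L \<le> card ?S" using P(3)[OF that] by (simp add: codegree_def c_def)
      ultimately have "L \<le> card (B p) + 2 * m"
        using diff_card_le_card_Diff[OF finZ, of ?S] cardZ by linarith
      then have "E * L \<le> E * (card (B p) + 2 * m)" by (intro mult_left_mono) auto
      then have "4 * (E * L) \<le> k * card (B p) + 8 * (E * m)"
        by (simp add: k_def algebra_simps)
      then have "n \<le> k * card (B p)" using L m1 hm Em by linarith
      moreover have "card (V - Z) \<le> n" using fin unfolding n_def by (intro card_mono) auto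
      ultimately show ?thesis by linarith
    qed
    have loc': "card (c ` {p \<in> P. x \<in> B p}) \<le> D" if "x \<in> V - Z" for x
    proof -
      have "c p \<in> (\<lambda>u. \<chi> {x, u}) ` (V - {x})" if "p \<in> P" "x \<in> B p" for p
      proof (rule image_eqI)
        show "c p = \<chi> {x, fst p}" using that by (simp add: B_def insert_commute[of x "fst p"])
        show "fst p \<in> V - {x}" using P(3)[OF that(1)] that \<open>x \<in> V - Z\<close> by (auto simp: Z_def)
      qed
      then have "card (c ` {p \<in> P. x \<in> B p}) \<le> card ((\<lambda>u. \<chi> {x, u}) ` (V - {x}))"
        using fin by (intro card_mono) auto
      then show ?thesis using loc that by (auto simp: local_colouring_def)
    qed
    have "n - 2 * m \<le> card (V - Z)"
      using diff_card_le_card_Diff[OF finZ, of V] cardZ unfolding n_def by linarith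
    moreover have "2 * k * s * card P = 8 * r" by (simp add: k_def r_def P(2))
    ultimately have few: "2 * k * (D * k + 1)\<^sup>2 * card P < card (V - Z)"
      using m1 hm Em mE \<open>n > 0\<close> unfolding s_def[symmetric] by linarith
    have finX: "finite (V - Z)" using fin by simp
    obtain ps f z w where ps: "length ps \<le> D * k" "distinct (concat ps)" "set (concat ps) = P"
      and f: "\<forall>p\<in>set ps. cyclic (\<lambda>i j. j = f i) p"
      and zw': "\<forall>p\<in>P. f p \<in> P \<and> c (f p) = c p \<and> z p \<in> B p \<inter> B (f p) \<and> w p \<in> B p"
      and inj: "inj_on z P" "inj_on w P" "z ` P \<inter> w ` P = {}"
      by (rule linking[OF P(1) finX sub large loc' few]; (assumption | (rule that; assumption)))
    have zw: "f p \<in> P" "c (f p) = c p" "z p \<in> B p" "z p \<in> B (f p)" "w p \<in> B p" if "p \<in> P" for p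
      using zw' that by auto
    define Q where "Q = Z \<union> z ` P"
    show ?thesis
    proof (intro exI conjI allI impI)
      show "w ` P \<subseteq> V" using zw(5) sub by blast
      show "Q \<subseteq> V" using zw(3) sub ZV unfolding Q_def by blast
      show "w ` P \<inter> Q = {}" using zw(5) sub inj(3) unfolding Q_def by blast
      show "card V \<le> 2 * h * card (w ` P)"
        using m2 card_image[OF inj(2)] P(2) by (simp add: n_def)
      fix W assume W: "W \<subseteq> w ` P"
      let ?seg = "\<lambda>p. (if w p \<in> W then [fst p, w p, snd p] else [fst p, snd p]) @ [z p]"
      have edges: "\<chi> {fst p, x} = c p" "\<chi> {snd p, x} = c p" "\<chi> {x, fst p} = c p" "\<chi> {x, snd p} = c p"
        if "x \<in> B p" for p x
        using that by (simp_all add: B_def insert_commute[of x])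
      have notZ: "x \<notin> Z" if "x \<in> B p" for p x using that sub by blast
      have inZ: "fst p \<in> Z" "snd p \<in> Z" if "p \<in> P" for p using that by (auto simp: Z_def)
      have zneqw: "z p \<noteq> w q" if "p \<in> P" "q \<in> P" for p q using inj(3) that by blast
      have segset: "set (?seg p) = {fst p, snd p, z p} \<union> ({w p} \<inter> W)" for p by auto
      have "cycle_partition \<chi> (\<Union>p\<in>set (concat ps). set (?seg p)) (length ps)"
      proof (rule cycle_partition_segments[OF ps(2), where c = c and f = f])
        fix p assume "p \<in> set (concat ps)"
        then have p: "p \<in> P" by (simp only: ps(3))
        have "fst p \<noteq> snd p" "w p \<noteq> z p" "fst p \<noteq> z p" "snd p \<noteq> z p" "fst p \<noteq> w p" "w p \<noteq> snd p"
          using P(3)[OF p] zneqw[OF p p] notZ[OF zw(3)[OF p]] notZ[OF zw(5)[OF p]] inZ[OF p] by auto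
        then show "?seg p \<noteq> [] \<and> distinct (?seg p) \<and> c (f p) = c p \<and>
          successively (\<lambda>u v. \<chi> {u, v} = c p) (?seg p) \<and> \<chi> {last (?seg p), hd (?seg (f p))} = c p"
          using zw(2)[OF p] edges[OF zw(3)[OF p]] edges[OF zw(4)[OF p]] edges[OF zw(5)[OF p]]
          by (simp add: c_def)
      next
        fix p q assume "p \<in> set (concat ps)" "q \<in> set (concat ps)" and pq: "p \<noteq> q"
        then have p: "p \<in> P" and q: "q \<in> P" by (simp_all only: ps(3))
        have "z p \<noteq> z q" "w p \<noteq> w q" using inj(1,2) p q pq by (auto simp: inj_on_def)
        then show "set (?seg p) \<inter> set (?seg q) = {}"
          using disj[OF p q pq] zneqw[OF p q] zneqw[OF q p] notZ[OF zw(3)[OF p]] notZ[OF zw(5)[OF p]]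
            notZ[OF zw(3)[OF q]] notZ[OF zw(5)[OF q]] inZ[OF p] inZ[OF q]
          unfolding segset by auto
      qed (use f in auto)
      moreover have "(\<Union>p\<in>set (concat ps). set (?seg p)) = Q \<union> W"
        using W unfolding ps(3) segset Q_def Z_def by blast
      ultimately show "cycle_partition \<chi> (Q \<union> W) (D * k)" using ps(1) by (metis cycle_partition_mono)
    qed
  qed
  then show ?thesis by blast
qed

section \<open>Partitions of locally coloured complete graphs\<close>

text \<open>Any few vertices can be covered through the others, so a fixed proportion of the vertices is
  always coverable.\<close>

lemma partial_partition:
  "\<exists>\<theta> N. 0 \<le> \<theta> \<and> \<theta> < 1 \<and> (\<forall>(\<chi> :: 'a set \<Rightarrow> 'c) V. finite V \<longrightarrow> local_colouring D \<chi> V \<longrightarrow>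
    (\<exists>A\<subseteq>V. cycle_partition \<chi> A N \<and> real (card (V - A)) \<le> \<theta> * real (card V)))"
proof -
  define K where "K = 2 * D * (D * D + 1)\<^sup>2"
  define \<theta> where "\<theta> = 1 - 1 / (2 * real (K + 2))"
  have "\<exists>A\<subseteq>V. cycle_partition \<chi> A (K + 2 + D * D) \<and> real (card (V - A)) \<le> \<theta> * real (card V)"
    if fin: "finite V" and loc: "local_colouring D \<chi> V" for \<chi> :: "'a set \<Rightarrow> 'c" and V
  proof (cases "card V < K + 2")
    case True
    have "0 \<le> \<theta>" by (simp add: \<theta>_def field_simps)
    moreover have "cycle_partition \<chi> V (K + 2 + D * D)"
      using True by (intro cycle_partition_mono[OF cycle_partition_singletons[OF fin]]) simp
    ultimately show ?thesis by (intro exI[of _ V]) auto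
  next
    case False
    define m where "m = card V div (K + 2)"
    have m: "(K + 2) * m \<le> card V" unfolding m_def by (rule times_div_less_eq_dividend)
    have "m \<ge> 1" using False by (simp add: m_def div_greater_zero_iff Suc_le_eq)
    have "card V < (K + 2) + (K + 2) * m" unfolding m_def by (intro dividend_less_times_div) simp
    moreover have "(K + 2) * 1 \<le> (K + 2) * m" using \<open>m \<ge> 1\<close> by (intro mult_left_mono) auto
    then have "K + 2 \<le> (K + 2) * m" by (simp only: mult_1_right)
    ultimately have m2: "card V \<le> 2 * ((K + 2) * m)" unfolding mult_2 by (rule order_trans[OF less_imp_le add_right_mono])
    have "m \<le> card V" using m by simp
    then obtain Y where Y: "Y \<subseteq> V" "card Y = m" by (meson obtain_subset_with_card_n)
    have "card (V - Y) = card V - m" using Y fin by (simp add: card_Diff_subset finite_subset)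
    then have "2 * D * (D * D + 1)\<^sup>2 * card Y < card (V - Y)"
      using m \<open>m \<ge> 1\<close> Y(2) unfolding K_def[symmetric] by simp
    then obtain A where A: "Y \<subseteq> A" "A \<subseteq> Y \<union> (V - Y)" "cycle_partition \<chi> A (D * D)"
      using cover_local[OF loc fin, of "V - Y" Y] Y by blast
    have "A \<subseteq> V" using A Y by blast
    have "card (V - A) \<le> card (V - Y)" using A fin by (intro card_mono) auto
    then have "card (V - A) + m \<le> card V" using \<open>card (V - Y) = card V - m\<close> \<open>m \<le> card V\<close> by linarith
    then have "real (card (V - A)) \<le> real (card V) - real m" by linarith
    moreover have "real (card V) / (2 * real (K + 2)) \<le> real m"
    proof -
      have "real (card V) \<le> real (2 * ((K + 2) * m))" using m2 by (simp only: of_nat_le_iff)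
      then show ?thesis by (simp add: field_simps)
    qed
    ultimately have "real (card (V - A)) \<le> \<theta> * real (card V)" by (simp add: \<theta>_def algebra_simps)
    then show ?thesis using \<open>A \<subseteq> V\<close> cycle_partition_mono[OF A(3)] by (intro exI[of _ A]) auto
  qed
  moreover have "0 \<le> \<theta>" "\<theta> < 1" by (auto simp: \<theta>_def field_simps)
  ultimately show ?thesis by blast
qed

lemma almost_partition:
  assumes "\<epsilon> > 0"
  shows "\<exists>N. \<forall>(\<chi> :: 'a set \<Rightarrow> 'c) V. finite V \<longrightarrow> local_colouring D \<chi> V \<longrightarrow>
    (\<exists>A\<subseteq>V. cycle_partition \<chi> A N \<and> real (card (V - A)) \<le> \<epsilon> * real (card V))"
proof -
  obtain \<theta> N where \<theta>: "0 \<le> \<theta>" "\<theta> < 1" and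
    N: "\<And>(\<chi> :: 'a set \<Rightarrow> 'c) V. finite V \<Longrightarrow> local_colouring D \<chi> V \<Longrightarrow>
      \<exists>A\<subseteq>V. cycle_partition \<chi> A N \<and> real (card (V - A)) \<le> \<theta> * real (card V)"
    using partial_partition[of D] by blast
  have iter: "\<exists>A\<subseteq>V. cycle_partition \<chi> A (s * N) \<and> real (card (V - A)) \<le> \<theta> ^ s * real (card V)"
    if fin: "finite V" and loc: "local_colouring D \<chi> V" for \<chi> :: "'a set \<Rightarrow> 'c" and V s
  proof (induction s)
    case 0
    show ?case using cycle_partition_empty by (intro exI[of _ "{}"]) auto
  next
    case (Suc s)
    then obtain A where A: "A \<subseteq> V" "cycle_partition \<chi> A (s * N)"
      "real (card (V - A)) \<le> \<theta> ^ s * real (card V)" by blast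
    have loc': "local_colouring D \<chi> (V - A)" by (rule local_colouring_subset[OF loc fin]) auto
    obtain A' where A': "A' \<subseteq> V - A" "cycle_partition \<chi> A' N"
      "real (card (V - A - A')) \<le> \<theta> * real (card (V - A))"
      using N[OF _ loc'] fin by blast
    have "cycle_partition \<chi> (A \<union> A') (s * N + N)"
      using A' by (intro cycle_partition_Un[OF A(2)]) auto
    moreover have "real (card (V - (A \<union> A'))) \<le> \<theta> ^ Suc s * real (card V)"
    proof -
      have "\<theta> * real (card (V - A)) \<le> \<theta> * (\<theta> ^ s * real (card V))"
        using A(3) \<theta>(1) by (rule mult_left_mono)
      then show ?thesis using A'(3) by (simp add: Diff_Un Diff_Diff_Int set_diff_eq Int_def conj_assoc mult.assoc)
    qed
    ultimately show ?case using A A' by (intro exI[of _ "A \<union> A'"]) (auto simp: add.commute)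
  qed
  obtain s where s: "\<theta> ^ s < \<epsilon>" using real_arch_pow_inv[OF assms \<theta>(2)] by blast
  have "\<exists>A\<subseteq>V. cycle_partition \<chi> A (s * N) \<and> real (card (V - A)) \<le> \<epsilon> * real (card V)"
    if fin: "finite V" and loc: "local_colouring D \<chi> V" for \<chi> :: "'a set \<Rightarrow> 'c" and V
  proof -
    obtain A where "A \<subseteq> V" "cycle_partition \<chi> A (s * N)" "real (card (V - A)) \<le> \<theta> ^ s * real (card V)"
      using iter[OF fin loc] by blast
    moreover have "\<theta> ^ s * real (card V) \<le> \<epsilon> * real (card V)" using s by (intro mult_right_mono) auto
    ultimately show ?thesis by (meson order_trans)
  qed
  then show ?thesis by blast
qed

text \<open>
  The method of Erdos, Gyarfas and Pyber: set an absorber aside, cover almost everything else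
  greedily, cover the few vertices left by means of optional vertices of the absorber, and let
  the absorber swallow the optional vertices that have not been used.\<close>

theorem local_cycle_partition:
  assumes D: "D \<ge> 1"
  shows "\<exists>N. \<forall>(\<chi> :: 'a set \<Rightarrow> 'c) V. finite V \<longrightarrow> local_colouring D \<chi> V \<longrightarrow> cycle_partition \<chi> V N"
proof -
  obtain h N\<^sub>1 where abs: "\<And>(\<chi> :: 'a set \<Rightarrow> 'c) V. finite V \<Longrightarrow> local_colouring D \<chi> V \<Longrightarrow> h \<le> card V \<Longrightarrow>
    \<exists>X Q. X \<subseteq> V \<and> Q \<subseteq> V \<and> X \<inter> Q = {} \<and> card V \<le> 2 * h * card X \<and>
      (\<forall>W\<subseteq>X. cycle_partition \<chi> (Q \<union> W) N\<^sub>1)"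
    using absorber[OF D] by metis
  define K where "K = 2 * D * (D * D + 1)\<^sup>2"
  define \<epsilon> where "\<epsilon> = 1 / (2 * real h * real K + 1)"
  have "\<epsilon> > 0" by (simp add: \<epsilon>_def add_nonneg_pos)
  then obtain N\<^sub>2 where alm: "\<And>(\<chi> :: 'a set \<Rightarrow> 'c) V. finite V \<Longrightarrow> local_colouring D \<chi> V \<Longrightarrow>
    \<exists>A\<subseteq>V. cycle_partition \<chi> A N\<^sub>2 \<and> real (card (V - A)) \<le> \<epsilon> * real (card V)"
    using almost_partition[of \<epsilon> D] by metis
  have "cycle_partition \<chi> V (h + (N\<^sub>1 + (N\<^sub>2 + D * D)))"
    if fin: "finite V" and loc: "local_colouring D \<chi> V" for \<chi> :: "'a set \<Rightarrow> 'c" and V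
  proof (cases "card V \<le> h \<or> card V = 0")
    case True
    then show ?thesis by (intro cycle_partition_mono[OF cycle_partition_singletons[OF fin]]) auto
  next
    case False
    then obtain X Q where XQ: "X \<subseteq> V" "Q \<subseteq> V" "X \<inter> Q = {}" "card V \<le> 2 * h * card X"
      "\<And>W. W \<subseteq> X \<Longrightarrow> cycle_partition \<chi> (Q \<union> W) N\<^sub>1"
      using abs[OF fin loc] by (metis nat_le_linear)
    define R where "R = V - (X \<union> Q)"
    have R: "R \<subseteq> V" "finite R" "local_colouring D \<chi> R"
      using fin local_colouring_subset[OF loc fin, of R] by (auto simp: R_def)
    obtain A where A: "A \<subseteq> R" "cycle_partition \<chi> A N\<^sub>2" "real (card (R - A)) \<le> \<epsilon> * real (card R)"
      using alm[OF R(2,3)] by blast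
    have "card R \<le> card V" using R fin by (intro card_mono)
    then have "\<epsilon> * real (card R) \<le> \<epsilon> * real (card V)" using \<open>\<epsilon> > 0\<close> by simp
    also have "\<dots> \<le> \<epsilon> * (2 * real h * real (card X))"
    proof -
      have "real (card V) \<le> real (2 * h * card X)" using XQ(4) by (simp only: of_nat_le_iff)
      then show ?thesis using \<open>\<epsilon> > 0\<close> by simp
    qed
    finally have small: "real (card (R - A)) \<le> \<epsilon> * (2 * real h * real (card X))" using A(3) by linarith
    have "card X > 0" using XQ(4) False by (cases "card X = 0") auto
    have "real K * real (card (R - A)) \<le> real K * (\<epsilon> * (2 * real h * real (card X)))"
      using small by (intro mult_left_mono) auto
    also have "\<dots> < real (card X)"
    proof -
      define a where "a = 2 * real h * real K"
      have "a \<ge> 0" by (simp add: a_def)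
      then have "a * \<epsilon> < 1" by (simp add: \<epsilon>_def a_def[symmetric])
      then have "a * \<epsilon> * real (card X) < 1 * real (card X)"
        using \<open>card X > 0\<close> by (intro mult_strict_right_mono) auto
      then show ?thesis by (simp add: a_def mult_ac)
    qed
    finally have "K * card (R - A) < card X" by (simp flip: of_nat_mult)
    then obtain A' where A': "R - A \<subseteq> A'" "A' \<subseteq> (R - A) \<union> X" "cycle_partition \<chi> A' (D * D)"
      using cover_local[OF loc fin, of X "R - A"] XQ R unfolding K_def R_def by blast
    have "cycle_partition \<chi> ((Q \<union> (X - A')) \<union> (A \<union> A')) (N\<^sub>1 + (N\<^sub>2 + D * D))"
    proof (intro cycle_partition_Un XQ(5) A(2) A'(3))
      show "A \<inter> A' = {}" using A(1) A'(2) by (auto simp: R_def)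
      show "(Q \<union> (X - A')) \<inter> (A \<union> A') = {}" using A(1) A'(2) XQ(3) by (auto simp: R_def)
    qed auto
    moreover have "(Q \<union> (X - A')) \<union> (A \<union> A') = V"
      using A(1) A'(1,2) XQ(1,2) by (auto simp: R_def)
    ultimately show ?thesis using cycle_partition_mono by (metis le_add2)
  qed
  then show ?thesis by blast
qed

section \<open>Covering the vertices of large colour-degree\<close>

lemma pairwise_intersecting_pairs:
  assumes "\<And>i. i \<in> I \<Longrightarrow> finite (S i) \<and> card (S i) \<le> 2"
    and int: "\<And>i j. i \<in> I \<Longrightarrow> j \<in> I \<Longrightarrow> S i \<inter> S j \<noteq> {}"
  shows "(\<exists>c. \<forall>i\<in>I. c \<in> S i) \<or> (\<exists>T. finite T \<and> card T \<le> 3 \<and> (\<forall>i\<in>I. S i \<subseteq> T))"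
proof (rule disjCI)
  assume "\<not> (\<exists>T. finite T \<and> card T \<le> 3 \<and> (\<forall>i\<in>I. S i \<subseteq> T))"
  then have noT: "\<exists>i\<in>I. \<not> S i \<subseteq> T" if "finite T" "card T \<le> 3" for T using that by blast
  show "\<exists>c. \<forall>i\<in>I. c \<in> S i"
  proof (rule ccontr)
    assume "\<nexists>c. \<forall>i\<in>I. c \<in> S i"
    then have noc: "\<exists>i\<in>I. c \<notin> S i" for c by blast
    have sub: "S i \<subseteq> {u, v}" if "i \<in> I" "u \<in> S i" "v \<in> S i" "u \<noteq> v" for i u v
    proof -
      have "{u, v} = S i" using assms(1)[OF that(1)] that(2-4) by (intro card_seteq) auto
      then show ?thesis by simp
    qed
    obtain i0 where i0: "i0 \<in> I" using noc by blast
    obtain a where a: "a \<in> S i0" using int[OF i0 i0] by blast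
    obtain i1 where i1: "i1 \<in> I" "a \<notin> S i1" using noc by blast
    obtain b where b: "b \<in> S i0" "b \<in> S i1" using int[OF i0 i1(1)] by blast
    have ab: "a \<noteq> b" using b i1 by blast
    obtain i2 where i2: "i2 \<in> I" "b \<notin> S i2" using noc by blast
    obtain e where e: "e \<in> S i1" "e \<in> S i2" using int[OF i1(1) i2(1)] by blast
    have eab: "e \<noteq> a" "e \<noteq> b" using e i1 i2 by auto
    have S0: "S i0 \<subseteq> {a, b}" using sub[OF i0 a b(1) ab] .
    have S1: "S i1 \<subseteq> {b, e}" using sub[OF i1(1) b(2) e(1)] eab(2)[symmetric] .
    have "a \<in> S i2" using int[OF i2(1) i0] S0 i2(2) by auto
    then have S2: "S i2 \<subseteq> {a, e}" using sub[OF i2(1) _ e(2)] eab(1)[symmetric] by simp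
    have "card {a, b, e} \<le> 3" by (simp add: card_insert_if)
    then obtain j where j: "j \<in> I" "\<not> S j \<subseteq> {a, b, e}" using noT[of "{a, b, e}"] by auto
    have "a \<in> S j \<or> b \<in> S j" using int[OF j(1) i0] S0 by auto
    moreover have "b \<in> S j \<or> e \<in> S j" using int[OF j(1) i1(1)] S1 by auto
    moreover have "a \<in> S j \<or> e \<in> S j" using int[OF j(1) i2(1)] S2 by auto
    ultimately consider "a \<in> S j" "b \<in> S j" | "b \<in> S j" "e \<in> S j" | "a \<in> S j" "e \<in> S j" by blast
    then have "S j \<subseteq> {a, b, e}"
    proof cases
      case 1
      then show ?thesis using sub[OF j(1) 1 ab] by auto
    next
      case 2
      then show ?thesis using sub[OF j(1) 2 eab(2)[symmetric]] by auto
    next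
      case 3
      then show ?thesis using sub[OF j(1) 3 eab(1)[symmetric]] by auto
    qed
    then show False using j by blast
  qed
qed

lemma balanced_assignment:
  assumes "finite L" "finite H" "card H \<le> card L * q"
  shows "\<exists>g. (\<forall>h\<in>H. g h \<in> L) \<and> (\<forall>c\<in>L. card {h \<in> H. g h = c} \<le> q)"
  using assms
proof (induction L arbitrary: H rule: finite_induct)
  case (insert c L)
  obtain H1 where H1: "H1 \<subseteq> H" "card H1 = min q (card H)"
    by (meson min.cobounded2 obtain_subset_with_card_n)
  have "card (H - H1) = card H - min q (card H)"
    using H1 insert.prems(1) by (simp add: card_Diff_subset finite_subset)
  moreover have "card H \<le> q + card L * q" using insert.prems(2) insert.hyps by simp
  ultimately have "card (H - H1) \<le> card L * q" by linarith
  then obtain g where g: "\<forall>h\<in>H - H1. g h \<in> L" "\<forall>c\<in>L. card {h \<in> H - H1. g h = c} \<le> q"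
    using insert.IH[of "H - H1"] insert.prems(1) by auto
  define f where "f = (\<lambda>h. if h \<in> H1 then c else g h)"
  have "{h \<in> H. f h = c} = H1" using H1(1) g(1) insert.hyps(2) by (auto simp: f_def)
  moreover have "{h \<in> H. f h = e} = {h \<in> H - H1. g h = e}" if "e \<in> L" for e
    using that insert.hyps(2) by (auto simp: f_def)
  ultimately show ?case
    using g H1(2) by (intro exI[of _ f]) (auto simp: f_def)
qed auto

text \<open>
  Here all the vertices of \<open>M\<close> see the colour \<open>c\<^sub>0\<close> and at most one further colour. A vertex \<open>h\<^sub>0\<close>
  of minimal colour-degree \<open>k\<close> in \<open>H\<close> that sees at least half of \<open>M\<close> in other colours than
  \<open>c\<^sub>0\<close> splits this half into at most \<open>k\<close> classes, according to the colour of the edges; while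
  \<open>H\<close> has at most \<open>6 * card M / k\<close> vertices. So either one of the large classes is much larger
  than \<open>H\<close>, or there are many classes whose size is at least a fixed fraction of that of \<open>H\<close>. In
  the second case \<open>H\<close> is shared out among \<open>4801\<close> of these classes. Between a class and \<open>H\<close> only two
  colours occur.\<close>

lemma cover_star_heavy:
  fixes \<chi> :: "'a set \<Rightarrow> 'c"
  defines "pal \<equiv> \<lambda>V v. (\<lambda>u. \<chi> {v, u}) ` (V - {v})"
  assumes fin: "finite V" and sub: "M \<subseteq> V" "H \<subseteq> V" "M \<inter> H = {}"
    and star: "\<And>x. x \<in> M \<Longrightarrow> c\<^sub>0 \<in> pal V x \<and> card (pal V x) \<le> 2"
    and sum: "(\<Sum>h\<in>H. card (pal V h)) \<le> 6 * card M"
    and few: "2000000 * card H \<le> card M"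
    and heavy: "\<And>h. h \<in> H \<Longrightarrow> card M \<le> 2 * card {x \<in> M. \<chi> {h, x} \<noteq> c\<^sub>0}"
  shows "\<exists>A. H \<subseteq> A \<and> A \<subseteq> H \<union> M \<and> card A \<le> 4 * card H \<and> cycle_partition \<chi> A 19204"
proof (cases "H = {}")
  case True
  then show ?thesis using cycle_partition_mono[OF cycle_partition_empty] by (intro exI[of _ "{}"]) auto
next
  case False
  have finH: "finite H" "finite M" using fin sub by (auto intro: finite_subset)
  have "card H > 0" using False finH by (simp add: card_gt_0_iff)
  then have Mpos: "card M > 0" using few by linarith
  obtain h\<^sub>0 where h0: "h\<^sub>0 \<in> H" "\<And>h. h \<in> H \<Longrightarrow> card (pal V h\<^sub>0) \<le> card (pal V h)"
    using finH(1) False ex_min_if_finite[of "(\<lambda>h. card (pal V h)) ` H"]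
    by (metis (no_types, lifting) arg_min_least arg_min_if_finite(1))
  define k where "k = card (pal V h\<^sub>0)"
  define S where "S = (\<lambda>c. {x \<in> M. \<chi> {h\<^sub>0, x} = c})"
  define C where "C = pal V h\<^sub>0 - {c\<^sub>0}"
  have finpal: "finite (pal V v)" for v using fin by (simp add: pal_def)
  have in_pal: "\<chi> {h, x} \<in> pal V h" "\<chi> {h, x} \<in> pal V x" if "h \<in> H" "x \<in> M" for h x
    using that sub unfolding pal_def by (auto intro!: image_eqI simp: insert_commute[of h x])
  have C: "finite C" "card C \<le> k" unfolding C_def k_def using finpal by (auto intro: card_mono)
  have "card H * k \<le> 6 * card M"
    using sum_bounded_below[of H k "\<lambda>h. card (pal V h)"] h0(2) sum by (simp add: k_def)
  have kpos: "k > 0"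
  proof -
    obtain x where "x \<in> M" using Mpos by (metis card.empty equals0I less_irrefl)
    then have "pal V h\<^sub>0 \<noteq> {}" using in_pal(1)[OF h0(1)] by blast
    then show ?thesis using finpal by (simp add: k_def card_gt_0_iff)
  qed
  have "{x \<in> M. \<chi> {h\<^sub>0, x} \<noteq> c\<^sub>0} \<subseteq> (\<Union>c\<in>C. S c)"
    using in_pal(1)[OF h0(1)] by (auto simp: S_def C_def)
  then have "card {x \<in> M. \<chi> {h\<^sub>0, x} \<noteq> c\<^sub>0} \<le> card (\<Union>c\<in>C. S c)"
    using finH C by (intro card_mono) (auto simp: S_def)
  also have "\<dots> \<le> (\<Sum>c\<in>C. card (S c))" by (rule card_UN_le[OF C(1)])
  finally have half: "card M \<le> 2 * (\<Sum>c\<in>C. card (S c))" using heavy[OF h0(1)] by linarith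
  \<comment> \<open>The large classes: the others together contain at most a quarter of \<open>M\<close>, hence at most half of the
    vertices that \<open>h\<^sub>0\<close> sees in other colours than \<open>c\<^sub>0\<close>.\<close>
  define Lg where "Lg = {c \<in> C. card M < 4 * k * card (S c)}"
  have LgC: "Lg \<subseteq> C" "finite Lg" using C by (auto simp: Lg_def)
  have quarter: "card M \<le> 4 * (\<Sum>c\<in>Lg. card (S c))"
  proof -
    have "4 * k * (\<Sum>c\<in>C - Lg. card (S c)) = (\<Sum>c\<in>C - Lg. 4 * k * card (S c))"
      by (simp add: sum_distrib_left)
    also have "\<dots> \<le> card (C - Lg) * card M"
      using sum_bounded_above[of "C - Lg" "\<lambda>c. 4 * k * card (S c)" "card M"] by (auto simp: Lg_def not_less)
    also have "\<dots> \<le> k * card M"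
      using C card_mono[OF C(1), of "C - Lg"] by (intro mult_right_mono) auto
    finally have "4 * (\<Sum>c\<in>C - Lg. card (S c)) \<le> card M" using kpos by simp
    moreover have "(\<Sum>c\<in>C. card (S c)) = (\<Sum>c\<in>C - Lg. card (S c)) + (\<Sum>c\<in>Lg. card (S c))"
      by (rule sum.subset_diff[OF LgC(1) C(1)])
    ultimately show ?thesis using half by linarith
  qed
  have large: "card H \<le> 24 * card (S c)" if "c \<in> Lg" for c
  proof -
    have "card M < 4 * k * card (S c)" using that by (simp add: Lg_def)
    then have "card H * k \<le> 6 * (4 * k * card (S c))"
      using \<open>card H * k \<le> 6 * card M\<close> by linarith
    then have "k * card H \<le> k * (24 * card (S c))" by (simp add: mult_ac)
    then show ?thesis using kpos by (simp only: mult_le_cancel1)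
  qed
  have cover: "\<exists>A. Y \<subseteq> A \<and> A \<subseteq> Y \<union> S c \<and> card A \<le> 2 * card Y \<and> cycle_partition \<chi> A 4"
    if Y: "Y \<subseteq> H" and c: "c \<in> C" and small: "100 * card Y < card (S c)" for Y c
  proof -
    have SM: "S c \<subseteq> M" by (auto simp: S_def)
    have two: "\<chi> {y, x} \<in> {c\<^sub>0, c}" if "y \<in> Y" "x \<in> S c" for y x
    proof -
      have x: "x \<in> M" "\<chi> {h\<^sub>0, x} = c" using that by (auto simp: S_def)
      have "{c\<^sub>0, c} \<subseteq> pal V x" "card {c\<^sub>0, c} = 2"
        using star[OF x(1)] in_pal(2)[OF h0(1) x(1)] x(2) c by (auto simp: C_def)
      then have "{c\<^sub>0, c} = pal V x" using star[OF x(1)] finpal by (intro card_seteq) auto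
      then show ?thesis using in_pal(2)[of y x] that Y x by blast
    qed
    have fin': "finite (S c)" "finite Y" using finH SM Y by (auto intro: finite_subset)
    have disj: "S c \<inter> Y = {}" using SM Y sub(3) by blast
    have card2: "card {c\<^sub>0, c} \<le> 2" by (simp add: card_insert_if)
    have "card ((\<lambda>y. \<chi> {y, x}) ` Y) \<le> 2" if "x \<in> S c" for x
      using card_mono[of "{c\<^sub>0, c}" "(\<lambda>y. \<chi> {y, x}) ` Y"] two that card2 by (meson finite.emptyI finite.insertI image_subsetI order_trans)
    moreover have "\<exists>e. card (S c) \<le> 2 * card {x \<in> S c. \<chi> {y, x} = e}" if "y \<in> Y" for y
      using two that by (intro popular_value[OF fin'(1) _ card2]) auto
    moreover have "2 * 2 * (2 * 2 + 1)\<^sup>2 * card Y < card (S c)" using small by simp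
    ultimately obtain A where "Y \<subseteq> A" "A \<subseteq> Y \<union> S c" "card A \<le> 2 * card Y" "cycle_partition \<chi> A (2 * 2)"
      using cover_small_set[OF fin' disj, where \<chi> = \<chi> and D = 2 and k = 2] by blast
    then show ?thesis by auto
  qed
  show ?thesis
  proof (cases "card Lg < 4801")
    case True
    have "\<exists>c\<in>Lg. card M \<le> 4 * 4801 * card (S c)"
    proof (rule ccontr)
      assume "\<not> ?thesis"
      then have "Suc (4 * 4801 * card (S c)) \<le> card M" if "c \<in> Lg" for c using that by (simp add: not_le Suc_le_eq)
      then have "(\<Sum>c\<in>Lg. 4 * 4801 * card (S c)) \<le> card Lg * (card M - 1)"
        using sum_bounded_above[of Lg "\<lambda>c. 4 * 4801 * card (S c)" "card M - 1"] by fastforce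
      also have "\<dots> \<le> 4801 * (card M - 1)" using True by (intro mult_right_mono) auto
      finally show False using quarter Mpos by (simp flip: sum_distrib_left)
    qed
    then obtain c where c: "c \<in> Lg" "card M \<le> 19204 * card (S c)" by auto
    then have "100 * card H < card (S c)" using few Mpos by linarith
    then obtain A where "H \<subseteq> A" "A \<subseteq> H \<union> S c" "card A \<le> 2 * card H" "cycle_partition \<chi> A 4"
      using cover[of H c] c LgC by blast
    moreover have "S c \<subseteq> M" by (auto simp: S_def)
    ultimately show ?thesis using cycle_partition_mono[where \<chi> = \<chi> and A = A and k = 4 and l = 19204] by (intro exI[of _ A]) auto
  next
    case False
    show ?thesis
    proof (cases "card H < 4801")
      case True
      then have "cycle_partition \<chi> H 19204"
        by (intro cycle_partition_mono[OF cycle_partition_singletons[OF finH(1)]]) simp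
      then show ?thesis by (intro exI[of _ H]) auto
    next
      case H: False
      obtain L where L: "L \<subseteq> Lg" "card L = 4801" using False by (meson not_less obtain_subset_with_card_n)
      have finL: "finite L" using L LgC finite_subset by blast
      \<comment> \<open>Each class has to serve at most \<open>2 * card H / 4801\<close> vertices and contains at least \<open>card H / 24\<close>,
        which leaves the factor of \<open>100 = 2 * 2 * (2 * 2 + 1)\<^sup>2\<close> that the covering lemma asks for.\<close>
      define q where "q = card H div 4801 + 1"
      have q: "card H \<le> 4801 * q" "4801 * q \<le> 2 * card H" 
        using H dividend_less_times_div[of 4801 "card H"] times_div_less_eq_dividend[of 4801 "card H"]
        unfolding q_def by simp_all
      obtain g where g: "\<And>h. h \<in> H \<Longrightarrow> g h \<in> L" "\<And>c. c \<in> L \<Longrightarrow> card {h \<in> H. g h = c} \<le> q"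
        using balanced_assignment[OF finL finH(1), of q] q(1) L(2) by auto
      define Y where "Y = (\<lambda>c. {h \<in> H. g h = c})"
      have "\<exists>A. Y c \<subseteq> A \<and> A \<subseteq> Y c \<union> S c \<and> card A \<le> 2 * card (Y c) \<and> cycle_partition \<chi> A 4" if "c \<in> L" for c
      proof (rule cover)
        have "4801 * q \<le> 48 * card (S c)" using q large[of c] L that by auto
        then show "100 * card (Y c) < card (S c)" using g(2)[OF that] by (simp add: Y_def q_def)
      qed (use that L LgC in \<open>auto simp: Y_def\<close>)
      then obtain A where A: "\<And>c. c \<in> L \<Longrightarrow> Y c \<subseteq> A c \<and> A c \<subseteq> Y c \<union> S c \<and> card (A c) \<le> 2 * card (Y c) \<and> cycle_partition \<chi> (A c) 4"
        by metis
      show ?thesis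
      proof (intro exI conjI)
        show "H \<subseteq> (\<Union>c\<in>L. A c)" using A g(1) by (fastforce simp: Y_def)
        show "(\<Union>c\<in>L. A c) \<subseteq> H \<union> M" using A by (fastforce simp: Y_def S_def)
        have "card (\<Union>c\<in>L. A c) \<le> (\<Sum>c\<in>L. card (A c))" by (rule card_UN_le[OF finL])
        also have "\<dots> \<le> card L * (2 * q)"
        proof -
          have "card (A c) \<le> 2 * q" if "c \<in> L" for c using A[OF that] g(2)[OF that] by (simp add: Y_def)
          then show ?thesis using sum_bounded_above[of L "\<lambda>c. card (A c)" "2 * q"] by simp
        qed
        also have "\<dots> \<le> 4 * card H" using q(2) L(2) by simp
        finally show "card (\<Union>c\<in>L. A c) \<le> 4 * card H" .
        have "cycle_partition \<chi> (\<Union>c\<in>L. A c) (card L * 4)"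
        proof (rule cycle_partition_UN[OF finL])
          show "cycle_partition \<chi> (A c) 4" if "c \<in> L" for c using A[OF that] by blast
          show "A c \<inter> A e = {}" if "c \<in> L" "e \<in> L" "c \<noteq> e" for c e
          proof -
            have "A c \<subseteq> Y c \<union> S c" "A e \<subseteq> Y e \<union> S e" using A that by auto
            then show ?thesis using that(3) sub(3) unfolding Y_def S_def by blast
          qed
        qed
        then show "cycle_partition \<chi> (\<Union>c\<in>L. A c) 19204" using L(2) by simp
      qed
    qed
  qed
qed

text \<open>
  A vertex of \<open>H\<close> is either joined to half of \<open>M\<close> in the colour \<open>c\<^sub>0\<close> or heavy in the sense of the
  previous lemma. The heavy vertices are covered first; they use up so few vertices of \<open>M\<close> that the
  linking through \<open>c\<^sub>0\<close>-edges still applies to the others.\<close>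

lemma cover_star:
  fixes \<chi> :: "'a set \<Rightarrow> 'c"
  defines "pal \<equiv> \<lambda>V v. (\<lambda>u. \<chi> {v, u}) ` (V - {v})"
  assumes fin: "finite V" and sub: "M \<subseteq> V" "H \<subseteq> V" "M \<inter> H = {}"
    and star: "\<And>x. x \<in> M \<Longrightarrow> c\<^sub>0 \<in> pal V x \<and> card (pal V x) \<le> 2"
    and sum: "(\<Sum>h\<in>H. card (pal V h)) \<le> 6 * card M"
    and few: "2000000 * card H \<le> card M" and M: "M \<noteq> {}"
  shows "\<exists>A. H \<subseteq> A \<and> A \<subseteq> H \<union> M \<and> cycle_partition \<chi> A 19212"
proof -
  have finH: "finite H" "finite M" using fin sub by (auto intro: finite_subset)
  have Mpos: "card M > 0" using M finH by (simp add: card_gt_0_iff)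
  define H1 where "H1 = {h \<in> H. card M \<le> 2 * card {x \<in> M. \<chi> {h, x} \<noteq> c\<^sub>0}}"
  define H2 where "H2 = H - H1"
  have H1: "H1 \<subseteq> H" "card H1 \<le> card H" and H2: "H2 \<subseteq> H" "card H2 \<le> card H"
    using finH by (auto simp: H1_def H2_def intro: card_mono)
  have "(\<Sum>h\<in>H1. card (pal V h)) \<le> (\<Sum>h\<in>H. card (pal V h))"
    using H1 finH by (intro sum_mono2) auto
  then have "(\<Sum>h\<in>H1. card (pal V h)) \<le> 6 * card M" "2000000 * card H1 \<le> card M"
    using sum few H1(2) by linarith+
  moreover have "H1 \<subseteq> V" "M \<inter> H1 = {}" using sub H1 by auto
  moreover have "card M \<le> 2 * card {x \<in> M. \<chi> {h, x} \<noteq> c\<^sub>0}" if "h \<in> H1" for h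
    using that by (simp add: H1_def)
  ultimately have "\<exists>A. H1 \<subseteq> A \<and> A \<subseteq> H1 \<union> M \<and> card A \<le> 4 * card H1 \<and> cycle_partition \<chi> A 19204"
    using star sub(1) unfolding pal_def by (intro cover_star_heavy[OF fin, where c\<^sub>0 = c\<^sub>0])
  then obtain A where A: "H1 \<subseteq> A" "A \<subseteq> H1 \<union> M" "card A \<le> 4 * card H1" "cycle_partition \<chi> A 19204"
    by blast
  have finA: "finite A" using A(2) H1 finH by (meson finite_Un finite_subset)
  define X where "X = M - A"
  have XM: "X \<subseteq> M" "finite X" using finH by (auto simp: X_def)
  have fin2: "finite H2" using H2 finH finite_subset by blast
  have disj: "X \<inter> H2 = {}" using XM H2 sub by blast
  have two: "card ((\<lambda>y. \<chi> {y, x}) ` H2) \<le> 2" if "x \<in> X" for x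
  proof -
    have "x \<in> M" using that XM by blast
    have "\<chi> {y, x} \<in> pal V x" if "y \<in> H2" for y
      unfolding pal_def
    proof (rule image_eqI)
      show "\<chi> {y, x} = \<chi> {x, y}" by (simp add: insert_commute[of y x])
      show "y \<in> V - {x}" using that H2 \<open>x \<in> M\<close> sub by blast
    qed
    then have "(\<lambda>y. \<chi> {y, x}) ` H2 \<subseteq> pal V x" by blast
    then have "card ((\<lambda>y. \<chi> {y, x}) ` H2) \<le> card (pal V x)"
      using fin by (intro card_mono) (auto simp: pal_def)
    then show ?thesis using star[OF \<open>x \<in> M\<close>] by linarith
  qed
  have maj: "\<exists>c. card X \<le> 4 * card {x \<in> X. \<chi> {y, x} = c}" if "y \<in> H2" for y
  proof -
    let ?E = "{x \<in> M. \<chi> {y, x} = c\<^sub>0}" and ?N = "{x \<in> M. \<chi> {y, x} \<noteq> c\<^sub>0}"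
    have "?E \<union> ?N = M" by auto
    then have "card M \<le> card ?E + card ?N" using card_Un_le[of ?E ?N] by (simp only:)
    moreover have "2 * card ?N < card M" using that by (auto simp: H2_def H1_def)
    moreover have "card ?E \<le> card (?E - A) + card A"
      using diff_card_le_card_Diff[OF finA, of ?E] by linarith
    moreover have "?E - A = {x \<in> X. \<chi> {y, x} = c\<^sub>0}" by (auto simp: X_def)
    moreover have "card X \<le> card M" using XM finH by (intro card_mono)
    ultimately have "card X \<le> 4 * card {x \<in> X. \<chi> {y, x} = c\<^sub>0}"
      using A(3) H1(2) few by simp
    then show ?thesis by blast
  qed
  have small: "2 * 4 * (2 * 4 + 1)\<^sup>2 * card H2 < card X"
  proof -
    have "card M - card A \<le> card X" unfolding X_def by (rule diff_card_le_card_Diff[OF finA])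
    then have "648 * card H2 < card X" using A(3) H1(2) H2(2) few Mpos by linarith
    then show ?thesis by simp
  qed
  obtain A' where A': "H2 \<subseteq> A'" "A' \<subseteq> H2 \<union> X" "cycle_partition \<chi> A' (2 * 4)"
    by (rule cover_small_set[OF XM(2) fin2 disj two maj small]; (assumption | (rule that; assumption)))
  have "A \<inter> A' = {}" using A(2) A'(2) sub(3) H1 H2 unfolding X_def H2_def by blast
  then have "cycle_partition \<chi> (A \<union> A') (19204 + 2 * 4)" using A(4) A'(3) by (intro cycle_partition_Un)
  moreover have "H \<subseteq> A \<union> A'" using A(1) A'(1) by (auto simp: H2_def)
  moreover have "A \<union> A' \<subseteq> H \<union> M" using A(2) A'(2) H1 H2 XM by blast
  ultimately show ?thesis by (intro exI[of _ "A \<union> A'"]) auto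
qed

text \<open>
  If the average colour-degree is at most \<open>3\<close>, the set \<open>H\<close> of the vertices of huge colour-degree
  must be compensated by a much larger set \<open>M\<close> of vertices of colour-degree at most \<open>2\<close>. The palettes
  of the latter intersect pairwise, hence they have a colour in common or contain at most three
  colours altogether. In the second case only three colours occur between \<open>H\<close> and \<open>M\<close>, and every
  vertex of \<open>H\<close> is joined to a third of \<open>M\<close> in one colour. The bound \<open>12000000\<close> is chosen such that
  \<open>M\<close> is large enough for every use of the linking lemma.\<close>

lemma cover_high_degrees:
  fixes \<chi> :: "'a set \<Rightarrow> 'c"
  defines "pal \<equiv> \<lambda>V v. (\<lambda>u. \<chi> {v, u}) ` (V - {v})"
  assumes fin: "finite V" and mean: "(\<Sum>v\<in>V. card (pal V v)) \<le> 3 * card V"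
  shows "\<exists>A\<subseteq>V. {v \<in> V. 12000000 < card (pal V v)} \<subseteq> A \<and> cycle_partition \<chi> A 19212"
proof -
  define d where "d = (\<lambda>v. card (pal V v))"
  define H where "H = {v \<in> V. 12000000 < d v}"
  define M where "M = {v \<in> V. d v \<le> 2}"
  have sub: "M \<subseteq> V" "H \<subseteq> V" "M \<inter> H = {}" by (auto simp: M_def H_def)
  have finH: "finite H" "finite M" using fin sub by (auto intro: finite_subset)
  have sum: "(\<Sum>h\<in>H. d h) \<le> 6 * card M"
  proof -
    \<comment> \<open>Above the bound, \<open>d v\<close> is at most twice the excess \<open>d v - 3\<close>, and a vertex of \<open>M\<close> makes up for an
      excess of at most \<open>3\<close>.\<close>
    have "(\<Sum>v\<in>V. 6 + (if v \<in> H then d v else 0)) \<le> (\<Sum>v\<in>V. 2 * d v + (if v \<in> M then 6 else 0))"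
      by (intro sum_mono) (auto simp: H_def M_def)
    moreover have "(\<Sum>v\<in>V. if v \<in> H then d v else 0) = (\<Sum>h\<in>H. d h)"
      using sub(2) fin by (simp add: sum.If_cases Int_absorb1 Int_absorb2 flip: sum.inter_restrict)
    moreover have "(\<Sum>v\<in>V. if v \<in> M then 6 else 0) = 6 * card M"
      using sub(1) fin by (simp add: sum.If_cases Int_absorb1 Int_absorb2)
    moreover have "(\<Sum>v\<in>V. 2 * d v) \<le> 6 * card V" using mean by (simp add: d_def flip: sum_distrib_left)
    ultimately show ?thesis by (simp add: sum.distrib)
  qed
  have "card H * 12000000 \<le> (\<Sum>h\<in>H. d h)"
    using sum_bounded_below[of H 12000000 d] by (simp add: H_def)
  then have few: "2000000 * card H \<le> card M" using sum by linarith
  have "\<exists>A. H \<subseteq> A \<and> A \<subseteq> H \<union> M \<and> cycle_partition \<chi> A 19212"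
  proof (cases "H = {}")
    case True
    then show ?thesis
      using cycle_partition_mono[OF cycle_partition_empty, of 19212 \<chi>] by (intro exI[of _ "{}"]) auto
  next
    case False
    then obtain h where h: "h \<in> H" by blast
    have "card H > 0" using False finH by (simp add: card_gt_0_iff)
    then have Mpos: "card M > 0" using few by linarith
    then have M: "M \<noteq> {}" by auto
    have finpal: "finite (pal V x)" for x using fin by (simp add: pal_def)
    have in_pal: "\<chi> {u, x} \<in> pal V x" if "x \<in> V" "u \<in> V" "u \<noteq> x" for u x
      unfolding pal_def using that by (intro image_eqI[where x = u]) (auto simp: insert_commute[of u x])
    have small: "card (pal V x) \<le> 2" if "x \<in> M" for x using that by (simp add: M_def d_def)
    have "pal V x \<inter> pal V y \<noteq> {}" if "x \<in> M" "y \<in> M" for x y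
    proof (cases "x = y")
      case True
      have "h \<in> V" "h \<noteq> x" "x \<in> V" using h that sub by auto
      then show ?thesis using in_pal[of x h] True by auto
    next
      case False
      then have "\<chi> {x, y} \<in> pal V y" "\<chi> {y, x} \<in> pal V x" using that sub(1) by (auto intro!: in_pal)
      then show ?thesis by (auto simp: insert_commute[of y x])
    qed
    then consider c where "\<forall>x\<in>M. c \<in> pal V x"
      | T where "finite T" "card T \<le> 3" "\<forall>x\<in>M. pal V x \<subseteq> T"
      using pairwise_intersecting_pairs[of M "pal V"] finpal small by blast
    then show ?thesis
    proof cases
      case (1 c)
      then show ?thesis
        using small sum unfolding d_def pal_def
        by (intro cover_star[OF fin sub _ _ few M, where c\<^sub>0 = c]) auto
    next
      case (2 T)
      have two: "card ((\<lambda>y. \<chi> {y, x}) ` H) \<le> 2" if "x \<in> M" for x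
      proof -
        have "(\<lambda>y. \<chi> {y, x}) ` H \<subseteq> pal V x" using sub that by (auto intro!: in_pal)
        then have "card ((\<lambda>y. \<chi> {y, x}) ` H) \<le> card (pal V x)" using finpal by (intro card_mono)
        then show ?thesis using small[OF that] by linarith
      qed
      have three: "\<exists>c. card M \<le> 3 * card {x \<in> M. \<chi> {y, x} = c}" if "y \<in> H" for y
      proof (rule popular_value[OF finH(2) 2(1,2)])
        have "\<chi> {y, x} \<in> pal V x" if "x \<in> M" for x using that \<open>y \<in> H\<close> sub by (auto intro!: in_pal)
        then show "(\<lambda>x. \<chi> {y, x}) ` M \<subseteq> T" using 2(3) by blast
      qed
      have small': "2 * 3 * (2 * 3 + 1)\<^sup>2 * card H < card M"
      proof -
        have "294 * card H < card M" using few Mpos by linarith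
        then show ?thesis by simp
      qed
      obtain A where "H \<subseteq> A" "A \<subseteq> H \<union> M" "cycle_partition \<chi> A (2 * 3)"
        by (rule cover_small_set[OF finH(2,1) sub(3) two three small']; (assumption | (rule that; assumption)))
      then show ?thesis using cycle_partition_mono[where \<chi> = \<chi> and k = "2 * 3" and l = 19212] by auto
    qed
  qed
  then obtain A where "H \<subseteq> A" "A \<subseteq> H \<union> M" "cycle_partition \<chi> A 19212" by blast
  then show ?thesis using sub by (intro exI[of _ A]) (auto simp: H_def d_def)
qed

section \<open>Colourings of mean colour-degree at most three\<close>

lemma colour_degree_complete:
  assumes "v \<in> V"
  shows "colour_degree (complete_edges V) \<chi> v = card ((\<lambda>u. \<chi> {v, u}) ` (V - {v}))"
proof -
  have edge: "{v, u} \<in> complete_edges V \<longleftrightarrow> u \<in> V - {v}" for u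
    using assms by (auto simp: complete_edges_def doubleton_eq_iff)
  show ?thesis
    unfolding colour_degree_def palette_def edge by (simp only: Setcompr_eq_image Collect_mem_eq)
qed

text \<open>Once the vertices of colour-degree above \<open>12000000\<close> are covered, the colouring of the remaining
  complete graph is \<open>12000000\<close>-local.\<close>

theorem theorem1p1:
  "\<exists>C::nat. \<forall>n::nat. n \<ge> 1 \<longrightarrow>
     (\<forall>\<chi> :: nat set \<Rightarrow> nat.
        mean_colouring 3 {..<n} (complete_edges {..<n}) \<chi> \<longrightarrow>
        partitioned_by_mono_cycles {..<n} (complete_edges {..<n}) \<chi> C)"
proof -
  have "\<exists>N. \<forall>(\<chi> :: nat set \<Rightarrow> nat) V. finite V \<longrightarrow> local_colouring 12000000 \<chi> V \<longrightarrow> cycle_partition \<chi> V N"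
    by (rule local_cycle_partition) simp
  then obtain N where N: "\<And>(\<chi> :: nat set \<Rightarrow> nat) V. finite V \<Longrightarrow> local_colouring 12000000 \<chi> V \<Longrightarrow> cycle_partition \<chi> V N"
    by blast
  have "cycle_partition \<chi> {..<n} (19212 + N)"
    if n: "n \<ge> 1" and mean: "mean_colouring 3 {..<n} (complete_edges {..<n}) \<chi>"
    for n :: nat and \<chi> :: "nat set \<Rightarrow> nat"
  proof -
    let ?V = "{..<n}"
    let ?d = "\<lambda>v. card ((\<lambda>u. \<chi> {v, u}) ` (?V - {v}))"
    have "(\<Sum>v\<in>?V. real (?d v)) \<le> 3 * real n"
    proof -
      have "(\<Sum>v\<in>?V. real (colour_degree (complete_edges ?V) \<chi> v)) = (\<Sum>v\<in>?V. real (?d v))"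
        by (intro sum.cong refl) (simp only: colour_degree_complete)
      then have "1 / real n * (\<Sum>v\<in>?V. real (?d v)) \<le> 3"
        using mean by (simp only: mean_colouring_def card_lessThan)
      then show ?thesis using n by (simp add: pos_divide_le_eq)
    qed
    then have "real (\<Sum>v\<in>?V. ?d v) \<le> real (3 * card ?V)" by simp
    then have "(\<Sum>v\<in>?V. ?d v) \<le> 3 * card ?V" by (simp only: of_nat_le_iff)
    then obtain A where A: "A \<subseteq> ?V" "{v \<in> ?V. 12000000 < ?d v} \<subseteq> A" "cycle_partition \<chi> A 19212"
      using cover_high_degrees[where V = ?V and \<chi> = \<chi>] finite_lessThan by blast
    have "local_colouring 12000000 \<chi> (?V - A)"
      unfolding local_colouring_def
    proof
      fix v assume v: "v \<in> ?V - A"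
      have "card ((\<lambda>u. \<chi> {v, u}) ` (?V - A - {v})) \<le> ?d v" by (intro card_mono) auto
      also have "\<dots> \<le> 12000000"
      proof (rule ccontr)
        assume "\<not> ?d v \<le> 12000000"
        then have "v \<in> A" using v A(2) by (intro subsetD[OF A(2)]) simp
        then show False using v by blast
      qed
      finally show "card ((\<lambda>u. \<chi> {v, u}) ` (?V - A - {v})) \<le> 12000000" .
    qed
    then have "cycle_partition \<chi> (?V - A) N" by (intro N) auto
    from cycle_partition_Un[OF A(3) this] have "cycle_partition \<chi> (A \<union> (?V - A)) (19212 + N)" by blast
    moreover have "A \<union> (?V - A) = ?V" using A(1) by blast
    ultimately show ?thesis by simp
  qed
  then show ?thesis by blast
qed

end
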